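(* Let $G$ be a finite group, let $\mathsf{S}$ be a supercharacter theory of $G$, and suppose that $H$ and $N$ are $\mathsf{S}$-normal subgroups of $G$. Let $\varphi: H/(H\cap N)\to HN/N$ be the group isomorphism $h(H\cap N)\mapsto hN$. Then the supercharacter theories $\mathsf{S}_{H/(H\cap N)}$ of $H/(H\cap N)$ and $\mathsf{S}_{HN/N}$ of $HN/N$ are isomorphic via $\varphi$.
   Context: All groups are finite. $\mathrm{Irr}(G)$ denotes the set of irreducible complex characters of $G$; for a character $\xi$, $\mathrm{Irr}(\xi)$ denotes its set of irreducible constituents. A supercharacter theory $\mathsf{S}$ of a group $G$ is a pair $(\mathcal{X}_{\mathsf{S}},\mathcal{K}_{\mathsf{S}})$, where $\mathcal{X}_{\mathsf{S}}$ is a partition of $\mathrm{Irr}(G)$ and $\mathcal{K}_{\mathsf{S}}$ is a partition of $G$ containing $\{1\}$, such that (i) $|\mathcal{K}_{\mathsf{S}}|=|\mathcal{X}_{\mathsf{S}}|$, and (ii) for each $X\in\mathcal{X}_{\mathsf{S}}$ there exists a character $\xi_X$ of $G$ such that $\mathrm{Irr}(\xi_X)\subseteq X$ and $\xi_X$ is constant on the parts of $\mathcal{K}_{\mathsf{S}}$. The parts of $\mathcal{K}_{\mathsf{S}}$ are called $\mathsf{S}$-classes (they are unions of conjugacy classes of $G$), and $\mathrm{Cl}(\mathsf{S})=\mathcal{K}_{\mathsf{S}}$ denotes the set of $\mathsf{S}$-classes. The set of classes determines the supercharacter theory uniquely. A subgroup of $G$ is $\mathsf{S}$-normal if it is a union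 of $\mathsf{S}$-classes (such a subgroup is normal in $G$). If $H$ and $N$ are $\mathsf{S}$-normal, then so are $H\cap N$ and $HN$ (known fact). If $M\le L$ are $\mathsf{S}$-normal subgroups of $G$, then $\mathsf{S}_{L/M}$ denotes the supercharacter theory of $L/M$ induced from $\mathsf{S}$: its classes are the images $\pi(K)$, under the canonical surjection $\pi:L\to L/M$, of the $\mathsf{S}$-classes $K$ with $K\subseteq L$. (It is a known fact that this is a supercharacter theory of $L/M$.) Given a group isomorphism $\varphi:A\to B$, a supercharacter theory $\mathsf{U}$ of $A$ and a supercharacter theory $\mathsf{T}$ of $B$, we say that $\mathsf{U}$ and $\mathsf{T}$ are isomorphic via $\varphi$, written $\mathsf{U}\simeq_\varphi\mathsf{T}$, if $\mathrm{Cl}(\mathsf{T})=\{\varphi(K):K\in\mathrm{Cl}(\mathsf{U})\}$. *)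

theory Defs
  imports
    "HOL-Algebra.Coset"
    "HOL-Library.Disjoint_Sets"
    "Jordan_Normal_Form.VS_Connect"
begin

section \<open>Complex characters of a group\<close>

text \<open>Representations have positive degree; in particular the zero function is not a character.\<close>

definition GL_mat :: "nat \<Rightarrow> complex mat monoid" where
  "GL_mat n = units_of (ring_mat TYPE(complex) n ())"

definition representation :: "('a, 'b) monoid_scheme \<Rightarrow> nat \<Rightarrow> ('a \<Rightarrow> complex mat) \<Rightarrow> bool" where
  "representation G n \<rho> \<longleftrightarrow> n > 0 \<and> \<rho> \<in> hom G (GL_mat n)"

definition irreducible_representation ::
  "('a, 'b) monoid_scheme \<Rightarrow> nat \<Rightarrow> ('a \<Rightarrow> complex mat) \<Rightarrow> bool" where
  "irreducible_representation G n \<rho> \<longleftrightarrow> representation G n \<rho> \<and>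
     (\<forall>W. VectorSpace.subspace class_ring W (module_vec TYPE(complex) n) \<and>
          (\<forall>g \<in> carrier G. \<forall>v \<in> W. \<rho> g *\<^sub>v v \<in> W)
        \<longrightarrow> W = {0\<^sub>v n} \<or> W = carrier_vec n)"

text \<open>Characters are made extensional (\<open>undefined\<close> outside \<open>carrier G\<close>), so that equality of
  functions is equality of characters.\<close>

definition afforded_character ::
  "('a, 'b) monoid_scheme \<Rightarrow> nat \<Rightarrow> ('a \<Rightarrow> complex mat) \<Rightarrow> 'a \<Rightarrow> complex" where
  "afforded_character G n \<rho> = (\<lambda>g \<in> carrier G. \<Sum>i<n. \<rho> g $$ (i, i))"

definition is_character :: "('a, 'b) monoid_scheme \<Rightarrow> ('a \<Rightarrow> complex) \<Rightarrow> bool" where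
  "is_character G \<chi> \<longleftrightarrow> (\<exists>n \<rho>. representation G n \<rho> \<and> \<chi> = afforded_character G n \<rho>)"

definition Irr :: "('a, 'b) monoid_scheme \<Rightarrow> ('a \<Rightarrow> complex) set" where
  "Irr G = {afforded_character G n \<rho> | n \<rho>. irreducible_representation G n \<rho>}"

definition irr_constituents ::
  "('a, 'b) monoid_scheme \<Rightarrow> ('a \<Rightarrow> complex) \<Rightarrow> ('a \<Rightarrow> complex) set" where
  "irr_constituents G \<xi> = {\<chi> \<in> Irr G. \<xi> = \<chi> \<or>
     (\<exists>\<psi>. is_character G \<psi> \<and> \<xi> = (\<lambda>g \<in> carrier G. \<chi> g + \<psi> g))}"


section \<open>Supercharacter theories\<close>

type_synonym 'a supercharacter_pair = "('a \<Rightarrow> complex) set set \<times> 'a set set"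

abbreviation Cl :: "'a supercharacter_pair \<Rightarrow> 'a set set" where
  "Cl S \<equiv> snd S"

definition supercharacter_theory ::
  "('a, 'b) monoid_scheme \<Rightarrow> 'a supercharacter_pair \<Rightarrow> bool" where
  "supercharacter_theory G S \<longleftrightarrow>
     partition_on (Irr G) (fst S) \<and>
     partition_on (carrier G) (Cl S) \<and> {\<one>\<^bsub>G\<^esub>} \<in> Cl S \<and>
     card (Cl S) = card (fst S) \<and>
     (\<forall>X \<in> fst S. \<exists>\<xi>. is_character G \<xi> \<and> irr_constituents G \<xi> \<subseteq> X \<and>
        (\<forall>K \<in> Cl S. \<forall>g \<in> K. \<forall>h \<in> K. \<xi> g = \<xi> h))"

definition S_normal ::
  "('a, 'b) monoid_scheme \<Rightarrow> 'a supercharacter_pair \<Rightarrow> 'a set \<Rightarrow> bool" where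
  "S_normal G S H \<longleftrightarrow> subgroup H G \<and> (\<exists>\<C> \<subseteq> Cl S. H = \<Union>\<C>)"

abbreviation quotient_group ::
  "('a, 'b) monoid_scheme \<Rightarrow> 'a set \<Rightarrow> 'a set \<Rightarrow> 'a set monoid" where
  "quotient_group G L M \<equiv> G\<lparr>carrier := L\<rparr> Mod M"

text \<open>
  The canonical surjection onto \<open>L / M\<close> is \<open>x \<mapsto> M #> x\<close>: elements of \<open>G Mod M\<close> are right cosets,
  which are also the left cosets since \<open>M\<close> is normal.

  The theory induced by \<open>S\<close> on \<open>L / M\<close> is given by its classes. A supercharacter theory is
  determined by its classes, so the first component is the one partition of \<open>Irr (L / M)\<close> that
  forms a supercharacter theory together with them.
\<close>

definition induced_classes ::
  "('a, 'b) monoid_scheme \<Rightarrow> 'a supercharacter_pair \<Rightarrow> 'a set \<Rightarrow> 'a set \<Rightarrow> 'a set set set" where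
  "induced_classes G S L M = {(\<lambda>x. M #>\<^bsub>G\<^esub> x) ` K | K. K \<in> Cl S \<and> K \<subseteq> L}"

definition induced_theory ::
  "('a, 'b) monoid_scheme \<Rightarrow> 'a supercharacter_pair \<Rightarrow> 'a set \<Rightarrow> 'a set
     \<Rightarrow> 'a set supercharacter_pair" where
  "induced_theory G S L M =
     (THE \<X>. supercharacter_theory (quotient_group G L M) (\<X>, induced_classes G S L M),
      induced_classes G S L M)"

definition isomorphic_via ::
  "('a, 'c) monoid_scheme \<Rightarrow> ('b, 'd) monoid_scheme \<Rightarrow> ('a \<Rightarrow> 'b)
     \<Rightarrow> 'a supercharacter_pair \<Rightarrow> 'b supercharacter_pair \<Rightarrow> bool" where
  "isomorphic_via A B \<phi> U T \<longleftrightarrow> \<phi> \<in> iso A B \<and> Cl T = {\<phi> ` K | K. K \<in> Cl U}"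

end

theory Submission
  imports Defs "Jordan_Normal_Form.Spectral_Radius" "HOL-Library.Function_Algebras"
    "HOL-Algebra.SndIsomorphismGrp"
begin

text \<open>
  The second isomorphism theorem makes \<open>\<phi>\<close> an isomorphism of groups, once \<open>N\<close> is known to be normal
  in \<open>G\<close>. It sends the image of a superclass \<open>K \<subseteq> H\<close> in \<open>H / (H \<inter> N)\<close> to the image of \<open>K\<close> in
  \<open>H N / N\<close>. So the content is that every superclass \<open>K \<subseteq> H N\<close> has the same image in \<open>G / N\<close> as some
  superclass contained in \<open>H\<close>. Choose an element \<open>n h\<close> of \<open>K\<close> with \<open>n \<in> N\<close> and \<open>h \<in> H\<close>, and let \<open>L\<close> be
  the superclass of \<open>h\<close>, which lies in \<open>H\<close>. The images of \<open>K\<close> and \<open>L\<close> meet, and images of superclasses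
  in \<open>G / N\<close> that meet are equal (\<open>superclass_image_eq\<close>), because \<open>N L\<close> and \<open>N K\<close> are unions of
  superclasses (\<open>set_mult_superclass_closed\<close>).

  The last fact needs character theory: functions that are constant on superclasses are closed under
  convolution (\<open>superclass_function_conv\<close>), and \<open>N L\<close> is the support of the convolution of two
  indicator functions. The functions that are constant on superclasses form a space whose dimension is
  the number of superclasses. A supercharacter theory provides equally many characters \<open>\<xi> X\<close> in this
  space with pairwise disjoint sets of constituents. By Schur orthogonality they are linearly
  independent, so they are a basis (\<open>supercharacter_basis\<close>), and \<open>\<xi> X * \<xi> Y = 0\<close> under convolution for
  \<open>X \<noteq> Y\<close>. The unit of convolution is constant on superclasses; expanding it in the basis shows that
  \<open>\<xi> X * \<xi> X\<close> is a multiple of \<open>\<xi> X\<close>. The basis consists of class functions, so superclasses are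
  unions of conjugacy classes and \<open>N\<close> is normal (\<open>S_normal_imp_normal\<close>).

  What is needed about characters is proved with matrices: every character is a combination of its
  irreducible constituents (\<open>character_decomposition\<close>), and convolution of irreducible characters
  obeys the orthogonality relations (\<open>conv_distinct_irreducible_characters\<close>,
  \<open>conv_irreducible_character_self\<close>).
\<close>

section \<open>Traces and coordinates on subspaces\<close>

definition mat_trace :: "complex mat \<Rightarrow> complex" where
  "mat_trace A = (\<Sum>i<dim_row A. A $$ (i, i))"

lemma mat_trace_mult:
  assumes "A \<in> carrier_mat n m" "B \<in> carrier_mat m n"
  shows "mat_trace (A * B) = (\<Sum>i<n. \<Sum>j<m. A $$ (i, j) * B $$ (j, i))"
  using assms by (auto simp: mat_trace_def scalar_prod_def atLeast0LessThan intro!: sum.cong)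

lemma mat_trace_commute:
  assumes "A \<in> carrier_mat n m" "B \<in> carrier_mat m n"
  shows "mat_trace (A * B) = mat_trace (B * A)"
proof -
  have "mat_trace (A * B) = (\<Sum>j<m. \<Sum>i<n. A $$ (i, j) * B $$ (j, i))"
    unfolding mat_trace_mult[OF assms] by (rule sum.swap)
  also have "\<dots> = mat_trace (B * A)"
    unfolding mat_trace_mult[OF assms(2,1)] by (simp add: mult.commute)
  finally show ?thesis .
qed

lemma mat_trace_add:
  assumes "A \<in> carrier_mat n n" "B \<in> carrier_mat n n"
  shows "mat_trace (A + B) = mat_trace A + mat_trace B"
  using assms by (auto simp: mat_trace_def sum.distrib)

lemma mat_trace_smult: "A \<in> carrier_mat n n \<Longrightarrow> mat_trace (c \<cdot>\<^sub>m A) = c * mat_trace A"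
  by (auto simp: mat_trace_def sum_distrib_left)

lemma mat_trace_one: "mat_trace (1\<^sub>m n) = of_nat n"
  by (auto simp: mat_trace_def)

lemma mat_eqI_vec:
  assumes A: "A \<in> carrier_mat n m" and B: "(B :: complex mat) \<in> carrier_mat n m"
    and eq: "\<And>v. v \<in> carrier_vec m \<Longrightarrow> A *\<^sub>v v = B *\<^sub>v v"
  shows "A = B"
proof (rule eq_matI)
  fix i j assume ij: "i < dim_row B" "j < dim_col B"
  have "M $$ (i, j) = (M *\<^sub>v unit_vec m j) $ i" if "M \<in> carrier_mat n m" for M :: "complex mat"
    using that ij B by auto
  then show "A $$ (i, j) = B $$ (i, j)" using A B eq[of "unit_vec m j"] by auto
qed (use A B in auto)

text \<open>
  The hypotheses compare dimensions rather than carriers, so that rewriting can discharge them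
  when it reassociates a product of rectangular matrices.
\<close>

lemma mat_assoc_dim:
  assumes "dim_col A = dim_row B" "dim_col B = dim_row C"
  shows "A * B * C = A * (B * (C :: complex mat))"
  by (rule assoc_mult_mat[of _ "dim_row A" "dim_col A" _ "dim_col B" _ "dim_col C"]) (use assms in auto)

lemma mat_vec_assoc_dim:
  assumes "dim_col A = dim_row B" "dim_col B = dim_vec v"
  shows "A * B *\<^sub>v v = A *\<^sub>v (B *\<^sub>v (v :: complex vec))"
  by (rule assoc_mult_mat_vec[of _ "dim_row A" "dim_col A" _ "dim_col B"]) (use assms in auto)

text \<open>
  If \<open>k\<close> were larger than \<open>n\<close>, padding both factors with zeros to square matrices would give an
  invertible matrix with a zero row.
\<close>

lemma left_inverse_imp_le:
  assumes U: "(U :: complex mat) \<in> carrier_mat n k" and V: "V \<in> carrier_mat k n"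
    and VU: "V * U = 1\<^sub>m k"
  shows "k \<le> n"
proof (rule ccontr)
  assume "\<not> k \<le> n"
  then have lt: "n < k" by simp
  define U' where "U' = mat k k (\<lambda>(i, j). if i < n then U $$ (i, j) else 0)"
  define V' where "V' = mat k k (\<lambda>(i, j). if j < n then V $$ (i, j) else 0)"
  have c: "U' \<in> carrier_mat k k" "V' \<in> carrier_mat k k" by (auto simp: U'_def V'_def)
  have "V' * U' = 1\<^sub>m k"
  proof (rule eq_matI)
    fix i j assume ij: "i < dim_row (1\<^sub>m k :: complex mat)" "j < dim_col (1\<^sub>m k :: complex mat)"
    have "(V' * U') $$ (i, j) = (\<Sum>l<k. if l < n then V $$ (i, l) * U $$ (l, j) else 0)"
      using ij by (auto simp: U'_def V'_def scalar_prod_def atLeast0LessThan intro!: sum.cong)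
    also have "\<dots> = (\<Sum>l<n. V $$ (i, l) * U $$ (l, j))"
      by (rule sum.mono_neutral_cong_right) (use lt in auto)
    also have "\<dots> = (V * U) $$ (i, j)"
      using ij U V by (auto simp: scalar_prod_def atLeast0LessThan intro!: sum.cong)
    finally show "(V' * U') $$ (i, j) = 1\<^sub>m k $$ (i, j)" by (simp add: VU)
  qed (auto simp: U'_def V'_def)
  then have "U' * V' = 1\<^sub>m k" using mat_mult_left_right_inverse[OF c(2,1)] by simp
  then have "(U' * V') $$ (n, n) = 1" using lt by simp
  moreover have "(U' * V') $$ (n, n) = 0"
    using lt by (simp add: U'_def V'_def scalar_prod_def)
  ultimately show False by simp
qed

definition lin_subspace :: "nat \<Rightarrow> complex vec set \<Rightarrow> bool" where
  "lin_subspace n W \<longleftrightarrow> W \<subseteq> carrier_vec n \<and> 0\<^sub>v n \<in> W \<and>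
     (\<forall>v\<in>W. \<forall>w\<in>W. v + w \<in> W) \<and> (\<forall>c. \<forall>v\<in>W. c \<cdot>\<^sub>v v \<in> W)"

lemma subspace_iff_lin_subspace:
  "VectorSpace.subspace class_ring W (module_vec TYPE(complex) n) \<longleftrightarrow> lin_subspace n W"
  unfolding VectorSpace.subspace_def submodule_def lin_subspace_def
  using vec_vs[of n, where ?'a = complex] vec_module[of n, where ?'a = complex]
  by (auto simp: module_vec_def)

text \<open>
  The vector \<open>u\<close> becomes a new last column of \<open>U\<close> and the functional \<open>r\<close> a new last row of \<open>V\<close>;
  the hypotheses say that \<open>u\<close> and \<open>r\<close> are dual to each other and annihilate the old rows and columns.
\<close>

lemma frame_extend:
  assumes U: "U \<in> carrier_mat n k" and V: "V \<in> carrier_mat k n" and VU: "V * U = 1\<^sub>m k"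
    and u: "u \<in> carrier_vec n" and Vu: "V *\<^sub>v u = 0\<^sub>v k"
    and r: "(r :: complex vec) \<in> carrier_vec n" and rU: "\<And>x. x \<in> carrier_vec k \<Longrightarrow> r \<bullet> (U *\<^sub>v x) = 0"
    and ru: "r \<bullet> u = 1"
  obtains U' V' where "U' \<in> carrier_mat n (Suc k)" "V' \<in> carrier_mat (Suc k) n" "V' * U' = 1\<^sub>m (Suc k)"
    "\<And>x. x \<in> carrier_vec (Suc k) \<Longrightarrow> U' *\<^sub>v x = U *\<^sub>v vec k (\<lambda>i. x $ i) + (x $ k) \<cdot>\<^sub>v u"
proof
  define U' where "U' = mat n (Suc k) (\<lambda>(i, j). if j < k then U $$ (i, j) else u $ i)"
  define V' where "V' = mat (Suc k) n (\<lambda>(i, j). if i < k then V $$ (i, j) else r $ j)"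
  show c: "U' \<in> carrier_mat n (Suc k)" "V' \<in> carrier_mat (Suc k) n" by (auto simp: U'_def V'_def)
  have colU: "col U' j = (if j < k then col U j else u)" if "j < Suc k" for j
    using that U u by (intro eq_vecI) (auto simp: U'_def)
  have rowV: "row V' j = (if j < k then row V j else r)" if "j < Suc k" for j
    using that V r by (intro eq_vecI) (auto simp: V'_def)
  have r0: "r \<bullet> col U j = 0" if "j < k" for j
  proof -
    have "U *\<^sub>v unit_vec k j = col U j" using that U by (intro eq_vecI) auto
    then show ?thesis using rU[of "unit_vec k j"] by simp
  qed
  have V0: "row V i \<bullet> u = 0" if "i < k" for i
    using arg_cong[OF Vu, of "\<lambda>x. x $ i"] that V by auto
  have VU': "row V i \<bullet> col U j = (if i = j then 1 else 0)" if "i < k" "j < k" for i j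
    using arg_cong[OF VU, of "\<lambda>x. x $$ (i, j)"] that V U by auto
  show "V' * U' = 1\<^sub>m (Suc k)"
  proof (rule eq_matI)
    fix i j assume "i < dim_row (1\<^sub>m (Suc k) :: complex mat)" "j < dim_col (1\<^sub>m (Suc k) :: complex mat)"
    then show "(V' * U') $$ (i, j) = 1\<^sub>m (Suc k) $$ (i, j)"
      using c by (auto simp: colU rowV r0 V0 VU' ru less_Suc_eq)
  qed (use c in auto)
  show "U' *\<^sub>v x = U *\<^sub>v vec k (\<lambda>i. x $ i) + (x $ k) \<cdot>\<^sub>v u" if "x \<in> carrier_vec (Suc k)" for x
    using that U u by (intro eq_vecI) (auto simp: U'_def scalar_prod_def)
qed

text \<open>
  Coordinates on a subspace: the columns of \<open>U\<close> are a basis of \<open>W\<close>, and \<open>V\<close> extends the coordinate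
  map of that basis to the whole space. A pair with the largest possible number of columns works,
  since a vector of \<open>W\<close> that \<open>U V\<close> moves would allow a further column.
\<close>

lemma subspace_frame:
  assumes W: "lin_subspace n W"
  obtains U k V where "U \<in> carrier_mat n k" "V \<in> carrier_mat k n" "V * U = 1\<^sub>m k"
    "\<And>x. x \<in> carrier_vec k \<Longrightarrow> U *\<^sub>v x \<in> W" "\<And>w. w \<in> W \<Longrightarrow> U *\<^sub>v (V *\<^sub>v w) = w"
proof -
  let ?P = "\<lambda>k. \<exists>U V. U \<in> carrier_mat n k \<and> V \<in> carrier_mat k n \<and> V * U = 1\<^sub>m k \<and>
    (\<forall>x\<in>carrier_vec k. U *\<^sub>v x \<in> W)"
  have Wc: "W \<subseteq> carrier_vec n" and W0: "0\<^sub>v n \<in> W" and Wa: "\<And>v w. v \<in> W \<Longrightarrow> w \<in> W \<Longrightarrow> v + w \<in> W"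
    and Ws: "\<And>c v. v \<in> W \<Longrightarrow> c \<cdot>\<^sub>v v \<in> W" using W by (auto simp: lin_subspace_def)
  have "?P 0"
  proof (intro exI conjI ballI)
    show "0\<^sub>m n 0 \<in> carrier_mat n 0" "0\<^sub>m 0 n \<in> carrier_mat 0 n" by auto
    show "0\<^sub>m 0 n * 0\<^sub>m n 0 = (1\<^sub>m 0 :: complex mat)" by auto
    fix x :: "complex vec" assume "x \<in> carrier_vec 0"
    then have "0\<^sub>m n 0 *\<^sub>v x = 0\<^sub>v n" by (intro eq_vecI) (auto simp: scalar_prod_def)
    then show "0\<^sub>m n 0 *\<^sub>v x \<in> W" using W0 by simp
  qed
  moreover have "\<forall>k. ?P k \<longrightarrow> k \<le> n" using left_inverse_imp_le by blast
  ultimately obtain k where k: "?P k" and max: "\<And>l. ?P l \<Longrightarrow> l \<le> k"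
    using Nat.ex_has_greatest_nat[of ?P 0 n] by auto
  then obtain U V where U: "U \<in> carrier_mat n k" and V: "V \<in> carrier_mat k n" and VU: "V * U = 1\<^sub>m k"
    and UW: "\<And>x. x \<in> carrier_vec k \<Longrightarrow> U *\<^sub>v x \<in> W" by blast
  have "U *\<^sub>v (V *\<^sub>v w) = w" if w: "w \<in> W" for w
  proof (rule ccontr)
    assume ne: "U *\<^sub>v (V *\<^sub>v w) \<noteq> w"
    have wc: "w \<in> carrier_vec n" using w Wc by auto
    define u where "u = w + (-1) \<cdot>\<^sub>v (U *\<^sub>v (V *\<^sub>v w))"
    have uW: "u \<in> W" unfolding u_def using U V wc w by (intro Wa Ws UW) auto
    have uc: "u \<in> carrier_vec n" using uW Wc by auto
    have VUx: "V *\<^sub>v (U *\<^sub>v x) = x" if "x \<in> carrier_vec k" for x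
      using assoc_mult_mat_vec[OF V U that] VU that by simp
    have Vu: "V *\<^sub>v u = 0\<^sub>v k"
    proof -
      have "V *\<^sub>v u = V *\<^sub>v w + V *\<^sub>v ((-1) \<cdot>\<^sub>v (U *\<^sub>v (V *\<^sub>v w)))"
        unfolding u_def using U V wc by (intro mult_add_distrib_mat_vec) auto
      also have "V *\<^sub>v ((-1) \<cdot>\<^sub>v (U *\<^sub>v (V *\<^sub>v w))) = (-1) \<cdot>\<^sub>v (V *\<^sub>v (U *\<^sub>v (V *\<^sub>v w)))"
        using U V wc by (intro mult_mat_vec) auto
      also have "V *\<^sub>v (U *\<^sub>v (V *\<^sub>v w)) = V *\<^sub>v w" using VUx V wc by simp
      finally show ?thesis using V wc by (intro eq_vecI) auto
    qed
    have "\<exists>i<n. u $ i \<noteq> 0"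
    proof (rule ccontr)
      assume "\<not> ?thesis"
      then have "u $ i = 0" if "i < n" for i using that by auto
      then have "w $ i = (U *\<^sub>v (V *\<^sub>v w)) $ i" if "i < n" for i
        using that wc U V by (force simp: u_def)
      then have "U *\<^sub>v (V *\<^sub>v w) = w" using wc U V by (intro eq_vecI) auto
      with ne show False by simp
    qed
    then obtain i where i: "i < n" "u $ i \<noteq> 0" by auto
    \<comment> \<open>the functional that takes the i-th coordinate, scaled, after the projection \<open>1 - U V\<close>\<close>
    define s where "s = (1 / u $ i) \<cdot>\<^sub>v unit_vec n i"
    define r where "r = s - (U * V)\<^sup>T *\<^sub>v s"
    have sc: "s \<in> carrier_vec n" by (simp add: s_def)
    have rc: "r \<in> carrier_vec n"
      unfolding r_def using U V sc by (intro minus_carrier_vec mult_mat_vec_carrier[of _ n n]) auto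
    have rv: "r \<bullet> v = s \<bullet> v - s \<bullet> (U *\<^sub>v (V *\<^sub>v v))" if v: "v \<in> carrier_vec n" for v
    proof -
      have UVc: "U * V \<in> carrier_mat n n" using U V by simp
      have "r \<bullet> v = s \<bullet> v - ((U * V)\<^sup>T *\<^sub>v s) \<bullet> v"
        unfolding r_def using U V sc v
        by (intro minus_scalar_prod_distrib[of _ n] mult_mat_vec_carrier[of _ n n]) auto
      also have "((U * V)\<^sup>T *\<^sub>v s) \<bullet> v = s \<bullet> ((U * V) *\<^sub>v v)"
        using transpose_vec_mult_scalar[OF UVc v sc] .
      finally show ?thesis using U V v by simp
    qed
    have "r \<bullet> (U *\<^sub>v x) = 0" if "x \<in> carrier_vec k" for x
      using rv[of "U *\<^sub>v x"] VUx[OF that] U that by simp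
    moreover have "r \<bullet> u = 1"
    proof -
      have "U *\<^sub>v (V *\<^sub>v u) = 0\<^sub>v n" unfolding Vu using U by (intro eq_vecI) auto
      then have "r \<bullet> u = s \<bullet> u" using rv[OF uc] sc by simp
      also have "\<dots> = 1" using i uc by (simp add: s_def)
      finally show ?thesis .
    qed
    ultimately obtain U' V' where UV': "U' \<in> carrier_mat n (Suc k)" "V' \<in> carrier_mat (Suc k) n"
      "V' * U' = 1\<^sub>m (Suc k)"
      and U'x: "\<And>x. x \<in> carrier_vec (Suc k) \<Longrightarrow> U' *\<^sub>v x = U *\<^sub>v vec k (\<lambda>i. x $ i) + (x $ k) \<cdot>\<^sub>v u"
      using frame_extend[OF U V VU uc Vu rc] by metis
    have "U' *\<^sub>v x \<in> W" if "x \<in> carrier_vec (Suc k)" for x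
      unfolding U'x[OF that] by (intro Wa Ws uW UW) auto
    then have "?P (Suc k)" using UV' by blast
    then show False using max[of "Suc k"] by simp
  qed
  then show ?thesis using that U V VU UW by blast
qed

text \<open>
  This provides coordinates on the image of a projection, and hence on a complement of a subspace.
\<close>

lemma idempotent_factorization:
  assumes E: "(E :: complex mat) \<in> carrier_mat n n" and EE: "E * E = E"
  obtains U k V where "U \<in> carrier_mat n k" "V \<in> carrier_mat k n" "V * U = 1\<^sub>m k" "U * V = E"
proof -
  have "lin_subspace n {v \<in> carrier_vec n. E *\<^sub>v v = v}"
    using E by (auto simp: lin_subspace_def mult_add_distrib_mat_vec mult_mat_vec)
  then obtain U k V where U: "U \<in> carrier_mat n k" and V: "V \<in> carrier_mat k n" and VU: "V * U = 1\<^sub>m k"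
    and UW: "\<And>x. x \<in> carrier_vec k \<Longrightarrow> U *\<^sub>v x \<in> {v \<in> carrier_vec n. E *\<^sub>v v = v}"
    and UV: "\<And>w. w \<in> {v \<in> carrier_vec n. E *\<^sub>v v = v} \<Longrightarrow> U *\<^sub>v (V *\<^sub>v w) = w"
    by (rule subspace_frame) blast
  have EU: "E * U = U" using UW E U by (intro mat_eqI_vec[of _ n k]) auto
  have UVE: "U * (V * E) = E"
  proof (rule mat_eqI_vec[of _ n n])
    fix v :: "complex vec" assume v: "v \<in> carrier_vec n"
    have "E *\<^sub>v (E *\<^sub>v v) = E *\<^sub>v v" using assoc_mult_mat_vec[OF E E v] EE by simp
    then have "U *\<^sub>v (V *\<^sub>v (E *\<^sub>v v)) = E *\<^sub>v v" using E v by (intro UV) auto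
    then show "(U * (V * E)) *\<^sub>v v = E *\<^sub>v v"
      using U V E v by (simp add: assoc_mult_mat_vec[of _ n k _ n] assoc_mult_mat_vec[of _ k n _ n])
  qed (use U V E in auto)
  have "(V * E) * U = 1\<^sub>m k" using U V E EU VU by simp
  then show ?thesis using that[of U k "V * E"] U V E UVE by simp
qed

section \<open>Characters as sums of irreducible constituents\<close>

lemma representation_iff:
  assumes "group G"
  shows "representation G n \<rho> \<longleftrightarrow> n > 0 \<and> (\<forall>g\<in>carrier G. \<rho> g \<in> carrier_mat n n) \<and>
    \<rho> \<one>\<^bsub>G\<^esub> = 1\<^sub>m n \<and> (\<forall>g\<in>carrier G. \<forall>h\<in>carrier G. \<rho> (g \<otimes>\<^bsub>G\<^esub> h) = \<rho> g * \<rho> h)"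
    (is "?L \<longleftrightarrow> ?R")
proof
  interpret group G by fact
  interpret R: ring "ring_mat TYPE(complex) n ()" by (rule ring_mat)
  have gr: "group (GL_mat n)" unfolding GL_mat_def by (rule R.units_group)
  have sim: "\<one>\<^bsub>GL_mat n\<^esub> = 1\<^sub>m n" "\<And>x y. x \<otimes>\<^bsub>GL_mat n\<^esub> y = x * y"
    "carrier (GL_mat n) \<subseteq> carrier_mat n n"
    by (auto simp: GL_mat_def units_of_def ring_mat_simps Units_def)
  {
    assume L: ?L
    then have h: "\<rho> \<in> hom G (GL_mat n)" by (simp add: representation_def)
    interpret group_hom G "GL_mat n" \<rho>
      using h gr by (simp add: group_hom_def group_hom_axioms_def is_group)
    show ?R using L hom_one hom_closed hom_mult sim by (auto simp: representation_def)
  }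
  {
    assume R: ?R
    have "\<rho> g \<in> carrier (GL_mat n)" if g: "g \<in> carrier G" for g
    proof -
      have "\<rho> (inv\<^bsub>G\<^esub> g) * \<rho> g = 1\<^sub>m n" "\<rho> g * \<rho> (inv\<^bsub>G\<^esub> g) = 1\<^sub>m n"
        using R g by (metis inv_closed l_inv r_inv)+
      then show ?thesis using R g
        by (auto simp: GL_mat_def units_of_def Units_def ring_mat_simps intro!: bexI[of _ "\<rho> (inv\<^bsub>G\<^esub> g)"])
    qed
    then show ?L using R by (auto simp: representation_def hom_def sim)
  }
qed

lemma representationD:
  assumes "group G" "representation G n \<rho>"
  shows "n > 0" "\<And>g. g \<in> carrier G \<Longrightarrow> \<rho> g \<in> carrier_mat n n" "\<rho> \<one>\<^bsub>G\<^esub> = 1\<^sub>m n"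
    "\<And>g h. g \<in> carrier G \<Longrightarrow> h \<in> carrier G \<Longrightarrow> \<rho> (g \<otimes>\<^bsub>G\<^esub> h) = \<rho> g * \<rho> h"
  using assms representation_iff by blast+

lemma afforded_character_eq:
  assumes "group G" "representation G n \<rho>" "g \<in> carrier G"
  shows "afforded_character G n \<rho> g = mat_trace (\<rho> g)"
  using representationD(2)[OF assms] assms(3) by (simp add: afforded_character_def mat_trace_def)

lemma Irr_is_character: "\<chi> \<in> Irr G \<Longrightarrow> is_character G \<chi>"
  unfolding Irr_def is_character_def irreducible_representation_def by blast

lemma character_one_nonzero:
  assumes "group G" "is_character G \<xi>"
  shows "\<xi> \<one>\<^bsub>G\<^esub> \<noteq> 0"
proof -
  obtain n \<rho> where r: "representation G n \<rho>" and x: "\<xi> = afforded_character G n \<rho>"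
    using assms(2) by (auto simp: is_character_def)
  have "\<xi> \<one>\<^bsub>G\<^esub> = of_nat n"
    using afforded_character_eq[OF assms(1) r, of "\<one>\<^bsub>G\<^esub>"] representationD(3)[OF assms(1) r] assms(1)
    by (simp add: x mat_trace_one group.is_monoid)
  then show ?thesis using representationD(1)[OF assms(1) r] by simp
qed

text \<open>
  The trace is invariant under cyclic permutation of a product.
\<close>

lemma character_conjugation_invariant:
  assumes G: "group G" and "is_character G \<xi>" and x: "x \<in> carrier G" and y: "y \<in> carrier G"
  shows "\<xi> (y \<otimes>\<^bsub>G\<^esub> x \<otimes>\<^bsub>G\<^esub> inv\<^bsub>G\<^esub> y) = \<xi> x"
proof -
  interpret group G by fact
  obtain n \<rho> where r: "representation G n \<rho>" and \<xi>: "\<xi> = afforded_character G n \<rho>"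
    using assms(2) by (auto simp: is_character_def)
  note R = representationD[OF G r]
  have "mat_trace (\<rho> ((y \<otimes>\<^bsub>G\<^esub> x) \<otimes>\<^bsub>G\<^esub> inv\<^bsub>G\<^esub> y)) = mat_trace (\<rho> (y \<otimes>\<^bsub>G\<^esub> x) * \<rho> (inv\<^bsub>G\<^esub> y))"
    using x y by (simp only: R(4) m_closed inv_closed)
  also have "\<dots> = mat_trace (\<rho> (inv\<^bsub>G\<^esub> y) * \<rho> (y \<otimes>\<^bsub>G\<^esub> x))"
    using x y by (intro mat_trace_commute[OF R(2) R(2)]) auto
  also have "\<rho> (inv\<^bsub>G\<^esub> y) * \<rho> (y \<otimes>\<^bsub>G\<^esub> x) = \<rho> x"
    using R(4)[of "inv\<^bsub>G\<^esub> y" "y \<otimes>\<^bsub>G\<^esub> x"] x y by (simp add: m_assoc[symmetric])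
  finally show ?thesis
    using x y by (simp add: \<xi> afforded_character_eq[OF G r])
qed

lemma direct_sum_representation:
  assumes G: "group G" and r: "representation G n \<rho>" and s: "representation G m \<sigma>"
  shows "representation G (n + m) (\<lambda>g. four_block_mat (\<rho> g) (0\<^sub>m n m) (0\<^sub>m m n) (\<sigma> g))"
    (is "representation G _ ?t")
  unfolding representation_iff[OF G]
proof (intro conjI ballI)
  note R = representationD[OF G r] and S = representationD[OF G s]
  show "0 < n + m" using R by simp
  show "?t g \<in> carrier_mat (n + m) (n + m)" if "g \<in> carrier G" for g using R(2)[OF that] S(2)[OF that] by simp
  show "?t \<one>\<^bsub>G\<^esub> = 1\<^sub>m (n + m)" using R(3) S(3) by simp
  show "?t (g \<otimes>\<^bsub>G\<^esub> h) = ?t g * ?t h" if "g \<in> carrier G" "h \<in> carrier G" for g h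
    using R(2)[OF that(1)] R(2)[OF that(2)] S(2)[OF that(1)] S(2)[OF that(2)] that
    by (subst mult_four_block_mat[of _ n n _ m _ m _ _ n _ m]) (auto simp: R(4) S(4))
qed

lemma sum_lessThan_add:
  fixes f :: "nat \<Rightarrow> complex"
  shows "(\<Sum>i<n + m. f i) = (\<Sum>i<n. f i) + (\<Sum>i<m. f (n + i))"
  by (induction m) (simp_all add: add.assoc)

lemma is_character_add:
  assumes G: "group G" and "is_character G \<xi>" and "is_character G \<psi>"
  shows "is_character G (\<lambda>g\<in>carrier G. \<xi> g + \<psi> g)"
proof -
  obtain n \<rho> where r: "representation G n \<rho>" and \<xi>: "\<xi> = afforded_character G n \<rho>"
    using assms(2) by (auto simp: is_character_def)
  obtain m \<sigma> where s: "representation G m \<sigma>" and \<psi>: "\<psi> = afforded_character G m \<sigma>"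
    using assms(3) by (auto simp: is_character_def)
  note R = representationD[OF G r] and S = representationD[OF G s]
  let ?t = "\<lambda>g. four_block_mat (\<rho> g) (0\<^sub>m n m) (0\<^sub>m m n) (\<sigma> g)"
  have "(\<Sum>i<n + m. ?t g $$ (i, i)) = (\<Sum>i<n. \<rho> g $$ (i, i)) + (\<Sum>i<m. \<sigma> g $$ (i, i))"
    if g: "g \<in> carrier G" for g
  proof -
    have "(\<Sum>i<n + m. ?t g $$ (i, i)) = (\<Sum>i<n. ?t g $$ (i, i)) + (\<Sum>i<m. ?t g $$ (n + i, n + i))"
      using sum_lessThan_add .
    also have "(\<Sum>i<n. ?t g $$ (i, i)) = (\<Sum>i<n. \<rho> g $$ (i, i))"
      using R(2)[OF g] S(2)[OF g] by (intro sum.cong) auto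
    also have "(\<Sum>i<m. ?t g $$ (n + i, n + i)) = (\<Sum>i<m. \<sigma> g $$ (i, i))"
      using R(2)[OF g] S(2)[OF g] by (intro sum.cong) auto
    finally show ?thesis .
  qed
  then have "(\<lambda>g\<in>carrier G. \<xi> g + \<psi> g) = afforded_character G (n + m) ?t"
    unfolding \<xi> \<psi> afforded_character_def by (intro restrict_ext) simp
  then show ?thesis using direct_sum_representation[OF G r s] unfolding is_character_def by blast
qed

text \<open>
  The product of the compressed matrices at \<open>g\<close> and \<open>h\<close> has an additional factor \<open>U V\<close> between
  \<open>\<rho> g\<close> and \<open>\<rho> h\<close>. The hypothesis \<open>inv\<close>, that this factor makes no difference, holds both for the
  coordinates on an invariant subspace and for those on a complement of one.
\<close>

lemma compressed_representation:
  assumes G: "group G" and r: "representation G n \<rho>"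
    and U: "U \<in> carrier_mat n k" and V: "V \<in> carrier_mat k n" and VU: "V * U = 1\<^sub>m k" and k: "k > 0"
    and inv: "\<And>g h. g \<in> carrier G \<Longrightarrow> h \<in> carrier G \<Longrightarrow>
      V * (\<rho> g * (U * V) * \<rho> h) * U = V * (\<rho> g * \<rho> h) * U"
  shows "representation G k (\<lambda>g. V * \<rho> g * U)"
  unfolding representation_iff[OF G]
proof (intro conjI ballI)
  note R = representationD[OF G r]
  show "V * \<rho> g * U \<in> carrier_mat k k" if "g \<in> carrier G" for g using R(2)[OF that] U V by simp
  show "V * \<rho> \<one>\<^bsub>G\<^esub> * U = 1\<^sub>m k" using R(3) U V VU by simp
  show "V * \<rho> (g \<otimes>\<^bsub>G\<^esub> h) * U = V * \<rho> g * U * (V * \<rho> h * U)"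
    if g: "g \<in> carrier G" and h: "h \<in> carrier G" for g h
  proof -
    have c: "\<rho> g \<in> carrier_mat n n" "\<rho> h \<in> carrier_mat n n" using R(2) g h by auto
    note d = carrier_matD[OF c(1)] carrier_matD[OF c(2)] carrier_matD[OF U] carrier_matD[OF V]
    have "V * \<rho> g * U * (V * \<rho> h * U) = V * (\<rho> g * (U * V) * \<rho> h) * U"
      by (simp only: mat_assoc_dim index_mult_mat(2,3) d)
    then show ?thesis using inv[OF g h] R(4)[OF g h] by simp
  qed
qed (rule k)

text \<open>
  In coordinates adapted to an invariant subspace \<open>W\<close> and any complement, the representation is
  block triangular; the diagonal blocks are representations and the trace is the sum of their
  traces.
\<close>

lemma reducible_character_splits:
  assumes G: "group G" and r: "representation G n \<rho>" and red: "\<not> irreducible_representation G n \<rho>"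
  obtains k \<alpha> l \<beta> where "representation G k \<alpha>" "representation G l \<beta>" "k < n" "l < n"
    "\<And>g. g \<in> carrier G \<Longrightarrow> afforded_character G n \<rho> g = afforded_character G k \<alpha> g + afforded_character G l \<beta> g"
proof -
  note R = representationD[OF G r]
  obtain W where W: "lin_subspace n W" and inv: "\<And>g v. g \<in> carrier G \<Longrightarrow> v \<in> W \<Longrightarrow> \<rho> g *\<^sub>v v \<in> W"
    and W0: "W \<noteq> {0\<^sub>v n}" and W1: "W \<noteq> carrier_vec n"
    using red r by (auto simp: irreducible_representation_def subspace_iff_lin_subspace)
  have Wc: "W \<subseteq> carrier_vec n" and z: "0\<^sub>v n \<in> W" using W by (auto simp: lin_subspace_def)
  obtain U k V where U: "U \<in> carrier_mat n k" and V: "V \<in> carrier_mat k n" and VU: "V * U = 1\<^sub>m k"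
    and UW: "\<And>x. x \<in> carrier_vec k \<Longrightarrow> U *\<^sub>v x \<in> W" and UVw: "\<And>w. w \<in> W \<Longrightarrow> U *\<^sub>v (V *\<^sub>v w) = w"
    by (rule subspace_frame[OF W]) blast
  define E where "E = U * V"
  have E: "E \<in> carrier_mat n n" using U V by (simp add: E_def)
  note dE = carrier_matD[OF U] carrier_matD[OF V] carrier_matD[OF E]
  have VE: "V * E = V"
  proof -
    have "V * E = V * U * V" unfolding E_def by (simp only: mat_assoc_dim index_mult_mat(2,3) dE)
    then show ?thesis unfolding VU using V by simp
  qed
  have EE: "E * E = E"
  proof -
    have "E * E = U * (V * E)" by (subst (1) E_def) (simp only: mat_assoc_dim index_mult_mat(2,3) dE)
    also have "\<dots> = E" unfolding VE by (rule E_def[symmetric])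
    finally show ?thesis .
  qed
  \<comment> \<open>\<open>E\<close> projects onto \<open>W\<close>, and \<open>F\<close> projects onto a complement of \<open>W\<close>\<close>
  define F where "F = 1\<^sub>m n - E"
  have F: "F \<in> carrier_mat n n" using E by (simp add: F_def minus_carrier_mat)
  have EF: "E + F = 1\<^sub>m n" unfolding F_def using E by (intro eq_matI) auto
  have FE: "F * E = 0\<^sub>m n n"
  proof -
    have "F * E = 1\<^sub>m n * E - E * E"
      unfolding F_def using E by (intro minus_mult_distrib_mat) auto
    then show ?thesis using E EE by simp
  qed
  have FF: "F * F = F"
  proof -
    have "F * F = F * 1\<^sub>m n - F * E"
      by (subst (2) F_def) (rule mult_minus_distrib_mat[OF F _ E], simp)
    also have "\<dots> = F" unfolding FE using F by (intro eq_matI) auto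
    finally show ?thesis .
  qed
  obtain U' l V' where U': "U' \<in> carrier_mat n l" and V': "V' \<in> carrier_mat l n"
    and V'U': "V' * U' = 1\<^sub>m l" and U'V': "U' * V' = F"
    by (rule idempotent_factorization[OF F FF])
  note d = dE carrier_matD[OF F] carrier_matD[OF U'] carrier_matD[OF V']
  have V'E: "V' * E = 0\<^sub>m l n"
  proof -
    have "V' * F = V' * U' * V'" unfolding U'V'[symmetric] by (simp only: mat_assoc_dim index_mult_mat(2,3) d)
    then have "V' * F = V'" unfolding V'U' using V' by simp
    then have "V' * E = V' * F * E" by simp
    also have "\<dots> = V' * (F * E)" by (simp only: mat_assoc_dim index_mult_mat(2,3) d)
    finally show ?thesis unfolding FE using V' by simp
  qed
  \<comment> \<open>invariance of \<open>W\<close>: the projection fixes the columns of \<open>\<rho> g * U\<close>, which lie in \<open>W\<close>\<close>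
  have ErhoU: "E * (\<rho> g * U) = \<rho> g * U" if g: "g \<in> carrier G" for g
  proof (rule mat_eqI_vec[of _ n k])
    fix v :: "complex vec" assume v: "v \<in> carrier_vec k"
    have "\<rho> g *\<^sub>v (U *\<^sub>v v) \<in> W" using inv[OF g UW[OF v]] .
    from UVw[OF this] show "(E * (\<rho> g * U)) *\<^sub>v v = (\<rho> g * U) *\<^sub>v v"
      unfolding E_def using v
      by (simp only: mat_vec_assoc_dim index_mult_mat(2,3) dim_mult_mat_vec dE carrier_matD[OF R(2)[OF g]] carrier_vecD)
  qed (use E R(2)[OF g] U in auto)
  have k0: "k > 0"
  proof (rule ccontr)
    assume "\<not> k > 0"
    then have "U *\<^sub>v (V *\<^sub>v w) = 0\<^sub>v n" if "w \<in> W" for w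
      using U V by (intro eq_vecI) (auto simp: scalar_prod_def)
    then have "W \<subseteq> {0\<^sub>v n}" using UVw by auto
    with z W0 show False by auto
  qed
  have l0: "l > 0"
  proof (rule ccontr)
    assume "\<not> l > 0"
    then have "F = 0\<^sub>m n n" unfolding U'V'[symmetric] using U' V'
      by (intro eq_matI) (auto simp: scalar_prod_def)
    then have E1: "E = 1\<^sub>m n" using EF E by simp
    have "v \<in> W" if v: "v \<in> carrier_vec n" for v
      using UW[of "V *\<^sub>v v"] V v assoc_mult_mat_vec[OF U V v] E1 by (simp add: E_def)
    with Wc W1 show False by auto
  qed
  have repk: "representation G k (\<lambda>g. V * \<rho> g * U)"
  proof (rule compressed_representation[OF G r U V VU k0])
    fix g h assume gh: "g \<in> carrier G" "h \<in> carrier G"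
    note dr = carrier_matD[OF R(2)[OF gh(1)]] carrier_matD[OF R(2)[OF gh(2)]]
    have "V * (\<rho> g * E * \<rho> h) * U = V * (\<rho> g * (E * (\<rho> h * U)))"
      by (simp only: mat_assoc_dim index_mult_mat(2,3) d dr)
    also have "\<dots> = V * (\<rho> g * \<rho> h) * U"
      unfolding ErhoU[OF gh(2)] by (simp only: mat_assoc_dim index_mult_mat(2,3) d dr)
    finally show "V * (\<rho> g * (U * V) * \<rho> h) * U = V * (\<rho> g * \<rho> h) * U" by (simp only: E_def)
  qed
  have repl: "representation G l (\<lambda>g. V' * \<rho> g * U')"
  proof (rule compressed_representation[OF G r U' V' V'U' l0])
    fix g h assume gh: "g \<in> carrier G" "h \<in> carrier G"
    have cg: "\<rho> g \<in> carrier_mat n n" and ch: "\<rho> h \<in> carrier_mat n n" using R(2) gh by auto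
    note dr = carrier_matD[OF cg] carrier_matD[OF ch]
    have "\<rho> g * E = E * (\<rho> g * U) * V"
      unfolding ErhoU[OF gh(1)] by (simp only: E_def mat_assoc_dim index_mult_mat(2,3) d dr)
    then have "V' * (\<rho> g * E) = (V' * E) * (\<rho> g * U * V)"
      by (simp only: mat_assoc_dim index_mult_mat(2,3) d dr)
    then have 0: "V' * (\<rho> g * E) = 0\<^sub>m l n"
      unfolding V'E using U V cg by simp
    have "\<rho> g = \<rho> g * (E + F)" using EF cg by simp
    also have "\<dots> = \<rho> g * E + \<rho> g * F" by (rule mult_add_distrib_mat[OF cg E F])
    finally have "V' * \<rho> g = V' * (\<rho> g * E + \<rho> g * F)" by (rule arg_cong)
    also have "\<dots> = V' * (\<rho> g * E) + V' * (\<rho> g * F)"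
      using cg E F by (intro mult_add_distrib_mat[OF V']) auto
    also have "\<dots> = V' * (\<rho> g * F)" unfolding 0 using V' cg F by simp
    finally have 1: "V' * \<rho> g = V' * (\<rho> g * F)" .
    have "V' * (\<rho> g * F * \<rho> h) * U' = V' * (\<rho> g * F) * (\<rho> h * U')"
      by (simp only: mat_assoc_dim index_mult_mat(2,3) d dr)
    also have "\<dots> = V' * (\<rho> g * \<rho> h) * U'"
      unfolding 1[symmetric] by (simp only: mat_assoc_dim index_mult_mat(2,3) d dr)
    finally show "V' * (\<rho> g * (U' * V') * \<rho> h) * U' = V' * (\<rho> g * \<rho> h) * U'" by (simp only: U'V')
  qed
  have kl: "k + l = n"
  proof -
    have "mat_trace (1\<^sub>m n) = mat_trace E + mat_trace F" unfolding EF[symmetric] by (rule mat_trace_add[OF E F])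
    also have "mat_trace E = mat_trace (1\<^sub>m k)" unfolding E_def VU[symmetric] by (rule mat_trace_commute[OF U V])
    also have "mat_trace F = mat_trace (1\<^sub>m l)" unfolding U'V'[symmetric] V'U'[symmetric]
      by (rule mat_trace_commute[OF U' V'])
    finally have "(of_nat n :: complex) = of_nat (k + l)" by (simp add: mat_trace_one)
    then show ?thesis by (simp only: of_nat_eq_iff)
  qed
  have tr: "mat_trace (\<rho> g) = mat_trace (V * \<rho> g * U) + mat_trace (V' * \<rho> g * U')"
    if g: "g \<in> carrier G" for g
  proof -
    have c: "\<rho> g \<in> carrier_mat n n" using R(2) g by auto
    note dr = carrier_matD[OF c]
    have "\<rho> g = \<rho> g * (E + F)" using EF c by simp
    also have "\<dots> = \<rho> g * E + \<rho> g * F" by (rule mult_add_distrib_mat[OF c E F])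
    finally have "mat_trace (\<rho> g) = mat_trace (\<rho> g * E + \<rho> g * F)" by (rule arg_cong)
    also have "\<dots> = mat_trace (\<rho> g * E) + mat_trace (\<rho> g * F)"
      by (rule mat_trace_add[of _ n]) (use c E F in auto)
    also have "\<rho> g * E = (\<rho> g * U) * V" unfolding E_def by (simp only: mat_assoc_dim index_mult_mat(2,3) d dr)
    also have "mat_trace \<dots> = mat_trace (V * (\<rho> g * U))" using c U V by (intro mat_trace_commute[of _ n k]) auto
    also have "V * (\<rho> g * U) = V * \<rho> g * U" by (simp only: mat_assoc_dim index_mult_mat(2,3) d dr)
    also have "\<rho> g * F = (\<rho> g * U') * V'" unfolding U'V'[symmetric] by (simp only: mat_assoc_dim index_mult_mat(2,3) d dr)
    also have "mat_trace \<dots> = mat_trace (V' * (\<rho> g * U'))" using c U' V' by (intro mat_trace_commute[of _ n l]) auto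
    also have "V' * (\<rho> g * U') = V' * \<rho> g * U'" by (simp only: mat_assoc_dim index_mult_mat(2,3) d dr)
    finally show ?thesis .
  qed
  show ?thesis
  proof (rule that[OF repk repl])
    show "k < n" "l < n" using kl k0 l0 by auto
    fix g assume g: "g \<in> carrier G"
    show "afforded_character G n \<rho> g = afforded_character G k (\<lambda>g. V * \<rho> g * U) g
        + afforded_character G l (\<lambda>g. V' * \<rho> g * U') g"
      unfolding afforded_character_eq[OF G r g] afforded_character_eq[OF G repk g] afforded_character_eq[OF G repl g]
      by (rule tr[OF g])
  qed
qed

lemma irr_constituents_add:
  assumes G: "group G" and \<psi>: "is_character G \<psi>"
  shows "irr_constituents G \<xi> \<subseteq> irr_constituents G (\<lambda>g\<in>carrier G. \<xi> g + \<psi> g)"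
proof
  fix \<chi> assume "\<chi> \<in> irr_constituents G \<xi>"
  then have \<chi>: "\<chi> \<in> Irr G"
    and or: "\<xi> = \<chi> \<or> (\<exists>\<theta>. is_character G \<theta> \<and> \<xi> = (\<lambda>g\<in>carrier G. \<chi> g + \<theta> g))"
    by (auto simp: irr_constituents_def)
  from or have "\<exists>\<theta>. is_character G \<theta> \<and> (\<lambda>g\<in>carrier G. \<xi> g + \<psi> g) = (\<lambda>g\<in>carrier G. \<chi> g + \<theta> g)"
  proof
    assume "\<exists>\<theta>. is_character G \<theta> \<and> \<xi> = (\<lambda>g\<in>carrier G. \<chi> g + \<theta> g)"
    then obtain \<theta> where \<theta>: "is_character G \<theta>" "\<xi> = (\<lambda>g\<in>carrier G. \<chi> g + \<theta> g)" by blast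
    show ?thesis
      by (rule exI[of _ "\<lambda>g\<in>carrier G. \<theta> g + \<psi> g"])
         (auto simp: \<theta>(2) add.assoc is_character_add[OF G \<theta>(1) \<psi>])
  qed (use \<psi> in auto)
  with \<chi> show "\<chi> \<in> irr_constituents G (\<lambda>g\<in>carrier G. \<xi> g + \<psi> g)"
    unfolding irr_constituents_def by blast
qed

lemma sum_support_add:
  fixes a b :: "'c \<Rightarrow> complex"
  assumes "finite A" "finite B"
  shows "(\<Sum>x\<in>A \<union> B. ((if x \<in> A then a x else 0) + (if x \<in> B then b x else 0)) * f x)
    = (\<Sum>x\<in>A. a x * f x) + (\<Sum>x\<in>B. b x * f x)"
proof -
  have "(\<Sum>x\<in>A \<union> B. (if x \<in> A then a x else 0) * f x) = (\<Sum>x\<in>A. a x * f x)"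
    by (rule sum.mono_neutral_cong_right) (use assms in auto)
  moreover have "(\<Sum>x\<in>A \<union> B. (if x \<in> B then b x else 0) * f x) = (\<Sum>x\<in>B. b x * f x)"
    by (rule sum.mono_neutral_cong_right) (use assms in auto)
  ultimately show ?thesis by (simp add: distrib_right sum.distrib)
qed

text \<open>
  Splitting a character of a reducible representation lowers the degree, so induction on the degree
  ends with irreducible characters. At each stage they are constituents, because the remaining
  summands add up to a character.
\<close>

lemma character_decomposition:
  assumes G: "group G" and "is_character G \<xi>"
  obtains F a where "finite F" "F \<subseteq> irr_constituents G \<xi>"
    "\<And>g. g \<in> carrier G \<Longrightarrow> \<xi> g = (\<Sum>\<chi>\<in>F. a \<chi> * \<chi> g)"
proof -
  have "\<exists>F a. finite F \<and> F \<subseteq> irr_constituents G (afforded_character G n \<rho>) \<and>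
    (\<forall>g\<in>carrier G. afforded_character G n \<rho> g = (\<Sum>\<chi>\<in>F. a \<chi> * \<chi> g))"
    if "representation G n \<rho>" for n \<rho>
    using that
  proof (induction n arbitrary: \<rho> rule: less_induct)
    case (less n)
    show ?case
    proof (cases "irreducible_representation G n \<rho>")
      case True
      then have "afforded_character G n \<rho> \<in> Irr G" by (auto simp: Irr_def)
      then show ?thesis
        by (intro exI[of _ "{afforded_character G n \<rho>}"] exI[of _ "\<lambda>_. 1"]) (auto simp: irr_constituents_def)
    next
      case False
      obtain k \<alpha> l \<beta> where \<alpha>: "representation G k \<alpha>" and \<beta>: "representation G l \<beta>" and kl: "k < n" "l < n"
        and eq: "\<And>g. g \<in> carrier G \<Longrightarrow> afforded_character G n \<rho> g = afforded_character G k \<alpha> g + afforded_character G l \<beta> g"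
        by (rule reducible_character_splits[OF G less.prems False]) blast
      let ?\<xi> = "afforded_character G n \<rho>" and ?\<alpha> = "afforded_character G k \<alpha>" and ?\<beta> = "afforded_character G l \<beta>"
      have c: "is_character G ?\<alpha>" "is_character G ?\<beta>" using \<alpha> \<beta> by (auto simp: is_character_def)
      have e: "?\<xi> \<in> extensional (carrier G)" by (simp add: afforded_character_def)
      have 1: "(\<lambda>g\<in>carrier G. ?\<alpha> g + ?\<beta> g) = ?\<xi>"
        by (rule extensionalityI[OF _ e]) (simp_all add: eq)
      have 2: "(\<lambda>g\<in>carrier G. ?\<beta> g + ?\<alpha> g) = ?\<xi>"
        by (rule extensionalityI[OF _ e]) (simp_all add: eq add.commute)
      obtain A a where A: "finite A" "A \<subseteq> irr_constituents G ?\<alpha>"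
        "\<And>g. g \<in> carrier G \<Longrightarrow> ?\<alpha> g = (\<Sum>\<chi>\<in>A. a \<chi> * \<chi> g)" using less.IH[OF kl(1) \<alpha>] by blast
      obtain B b where B: "finite B" "B \<subseteq> irr_constituents G ?\<beta>"
        "\<And>g. g \<in> carrier G \<Longrightarrow> ?\<beta> g = (\<Sum>\<chi>\<in>B. b \<chi> * \<chi> g)" using less.IH[OF kl(2) \<beta>] by blast
      define c' where "c' = (\<lambda>\<chi>. (if \<chi> \<in> A then a \<chi> else 0) + (if \<chi> \<in> B then b \<chi> else 0))"
      have "A \<union> B \<subseteq> irr_constituents G ?\<xi>"
        using A(2) B(2) irr_constituents_add[OF G c(2), of ?\<alpha>] irr_constituents_add[OF G c(1), of ?\<beta>]
        unfolding 1 2 by blast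
      moreover have "?\<xi> g = (\<Sum>\<chi>\<in>A \<union> B. c' \<chi> * \<chi> g)" if g: "g \<in> carrier G" for g
        unfolding eq[OF g] A(3)[OF g] B(3)[OF g] c'_def by (rule sum_support_add[OF A(1) B(1), symmetric])
      ultimately show ?thesis using A(1) B(1) by (intro exI[of _ "A \<union> B"] exI[of _ c']) blast
    qed
  qed
  moreover obtain n \<rho> where "representation G n \<rho>" "\<xi> = afforded_character G n \<rho>"
    using assms(2) by (auto simp: is_character_def)
  ultimately have "\<exists>F a. finite F \<and> F \<subseteq> irr_constituents G \<xi> \<and> (\<forall>g\<in>carrier G. \<xi> g = (\<Sum>\<chi>\<in>F. a \<chi> * \<chi> g))"
    by (simp only:)
  then show ?thesis using that by (elim exE conjE) simp
qed

section \<open>Schur's lemma and convolution of irreducible characters\<close>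

text \<open>
  The commuting matrix has an eigenvalue over the complex numbers, and its eigenspace is a nonzero
  invariant subspace.
\<close>

lemma schur_scalar:
  assumes G: "group G" and irr: "irreducible_representation G n \<rho>"
    and M: "M \<in> carrier_mat n n" and comm: "\<And>g. g \<in> carrier G \<Longrightarrow> \<rho> g * M = M * \<rho> g"
  obtains c where "M = c \<cdot>\<^sub>m 1\<^sub>m n"
proof -
  have r: "representation G n \<rho>" using irr by (simp add: irreducible_representation_def)
  note R = representationD[OF G r]
  obtain c v where v: "v \<in> carrier_vec n" "v \<noteq> 0\<^sub>v n" and Mv: "M *\<^sub>v v = c \<cdot>\<^sub>v v"
    using spectrum_non_empty[OF M R(1)] M by (auto simp: spectrum_def eigenvalue_def eigenvector_def)
  let ?W = "{v \<in> carrier_vec n. M *\<^sub>v v = c \<cdot>\<^sub>v v}"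
  have "lin_subspace n ?W"
    unfolding lin_subspace_def
  proof (intro conjI ballI allI)
    show "0\<^sub>v n \<in> ?W" using M by (auto intro!: eq_vecI)
    show "v + w \<in> ?W" if "v \<in> ?W" "w \<in> ?W" for v w
      using that M by (auto simp: mult_add_distrib_mat_vec[of _ n n] smult_add_distrib_vec)
    show "a \<cdot>\<^sub>v v \<in> ?W" if "v \<in> ?W" for a v
      using that M by (auto simp: mult_mat_vec[of _ n n] smult_smult_assoc mult.commute)
  qed auto
  moreover have "\<rho> g *\<^sub>v w \<in> ?W" if g: "g \<in> carrier G" and w: "w \<in> ?W" for g w
  proof -
    have rg: "\<rho> g \<in> carrier_mat n n" using R(2) g by auto
    have "M *\<^sub>v (\<rho> g *\<^sub>v w) = (M * \<rho> g) *\<^sub>v w" using M rg w by (intro assoc_mult_mat_vec[symmetric]) auto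
    also have "\<dots> = \<rho> g *\<^sub>v (M *\<^sub>v w)"
      unfolding comm[OF g, symmetric] using M rg w by (intro assoc_mult_mat_vec) auto
    also have "M *\<^sub>v w = c \<cdot>\<^sub>v w" using w by simp
    also have "\<rho> g *\<^sub>v (c \<cdot>\<^sub>v w) = c \<cdot>\<^sub>v (\<rho> g *\<^sub>v w)" using rg w by (intro mult_mat_vec) auto
    finally show ?thesis using rg w by simp
  qed
  ultimately have "?W = {0\<^sub>v n} \<or> ?W = carrier_vec n"
    using irr unfolding irreducible_representation_def subspace_iff_lin_subspace by blast
  moreover have "v \<in> ?W" using v Mv by simp
  ultimately have W: "?W = carrier_vec n" using v(2) by auto
  have "M = c \<cdot>\<^sub>m 1\<^sub>m n"
  proof (rule mat_eqI_vec[of _ n n])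
    fix w :: "complex vec" assume w: "w \<in> carrier_vec n"
    then have "M *\<^sub>v w = c \<cdot>\<^sub>v w" using W by auto
    moreover have "(c \<cdot>\<^sub>m 1\<^sub>m n) *\<^sub>v w = c \<cdot>\<^sub>v w" using w by (intro eq_vecI) auto
    ultimately show "M *\<^sub>v w = (c \<cdot>\<^sub>m 1\<^sub>m n) *\<^sub>v w" by simp
  qed (use M in auto)
  then show ?thesis by (rule that)
qed

text \<open>
  The dimensions are arguments, so that the sum over the empty set is a matrix of the right size.
\<close>

definition mat_sum :: "nat \<Rightarrow> nat \<Rightarrow> ('c \<Rightarrow> complex mat) \<Rightarrow> 'c set \<Rightarrow> complex mat" where
  "mat_sum n m f A = mat n m (\<lambda>(i, j). \<Sum>x\<in>A. f x $$ (i, j))"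

lemma mat_sum_carrier [simp]: "mat_sum n m f A \<in> carrier_mat n m"
  by (simp add: mat_sum_def)

lemma mat_sum_index [simp]: "i < n \<Longrightarrow> j < m \<Longrightarrow> mat_sum n m f A $$ (i, j) = (\<Sum>x\<in>A. f x $$ (i, j))"
  by (simp add: mat_sum_def)

lemma mat_sum_dim [simp]: "dim_row (mat_sum n m f A) = n" "dim_col (mat_sum n m f A) = m"
  by (simp_all add: mat_sum_def)

lemma mat_sum_cong: "(\<And>x. x \<in> A \<Longrightarrow> f x = g x) \<Longrightarrow> mat_sum n m f A = mat_sum n m g A"
  unfolding mat_sum_def by (intro cong_mat) (auto intro!: sum.cong)

lemma mat_sum_reindex:
  assumes "bij_betw h B A"
  shows "mat_sum n m (\<lambda>x. f (h x)) B = mat_sum n m f A"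
  unfolding mat_sum_def
  by (intro cong_mat) (auto intro: sum.reindex_bij_betw[OF assms])

lemma mult_mat_sum:
  assumes "B \<in> carrier_mat k n" "\<And>x. x \<in> A \<Longrightarrow> f x \<in> carrier_mat n m"
  shows "B * mat_sum n m f A = mat_sum k m (\<lambda>x. B * f x) A"
proof (rule eq_matI)
  fix i j assume "i < dim_row (mat_sum k m (\<lambda>x. B * f x) A)" "j < dim_col (mat_sum k m (\<lambda>x. B * f x) A)"
  then have ij: "i < k" "j < m" by auto
  have "(B * mat_sum n m f A) $$ (i, j) = (\<Sum>l<n. \<Sum>x\<in>A. B $$ (i, l) * f x $$ (l, j))"
    using assms(1) ij by (simp add: scalar_prod_def atLeast0LessThan sum_distrib_left)
  also have "\<dots> = (\<Sum>x\<in>A. \<Sum>l<n. B $$ (i, l) * f x $$ (l, j))" by (rule sum.swap)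
  also have "\<dots> = (\<Sum>x\<in>A. (B * f x) $$ (i, j))"
  proof (rule sum.cong)
    fix x assume "x \<in> A"
    then show "(\<Sum>l<n. B $$ (i, l) * f x $$ (l, j)) = (B * f x) $$ (i, j)"
      using assms(1) assms(2)[of x] ij by (auto simp: scalar_prod_def atLeast0LessThan)
  qed simp
  finally show "(B * mat_sum n m f A) $$ (i, j) = mat_sum k m (\<lambda>x. B * f x) A $$ (i, j)" using ij by simp
qed (use assms in auto)

lemma mat_sum_mult:
  assumes "B \<in> carrier_mat m k" "\<And>x. x \<in> A \<Longrightarrow> f x \<in> carrier_mat n m"
  shows "mat_sum n m f A * B = mat_sum n k (\<lambda>x. f x * B) A"
proof (rule eq_matI)
  fix i j assume "i < dim_row (mat_sum n k (\<lambda>x. f x * B) A)" "j < dim_col (mat_sum n k (\<lambda>x. f x * B) A)"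
  then have ij: "i < n" "j < k" by auto
  have "(mat_sum n m f A * B) $$ (i, j) = (\<Sum>l<m. \<Sum>x\<in>A. f x $$ (i, l) * B $$ (l, j))"
    using assms(1) ij by (simp add: scalar_prod_def atLeast0LessThan sum_distrib_right)
  also have "\<dots> = (\<Sum>x\<in>A. \<Sum>l<m. f x $$ (i, l) * B $$ (l, j))" by (rule sum.swap)
  also have "\<dots> = (\<Sum>x\<in>A. (f x * B) $$ (i, j))"
  proof (rule sum.cong)
    fix x assume "x \<in> A"
    then show "(\<Sum>l<m. f x $$ (i, l) * B $$ (l, j)) = (f x * B) $$ (i, j)"
      using assms(1) assms(2)[of x] ij by (auto simp: scalar_prod_def atLeast0LessThan)
  qed simp
  finally show "(mat_sum n m f A * B) $$ (i, j) = mat_sum n k (\<lambda>x. f x * B) A $$ (i, j)" using ij by simp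
qed (use assms in auto)

lemma mat_trace_mat_sum:
  assumes "\<And>x. x \<in> A \<Longrightarrow> f x \<in> carrier_mat n n"
  shows "mat_trace (mat_sum n n f A) = (\<Sum>x\<in>A. mat_trace (f x))"
proof -
  have "mat_trace (mat_sum n n f A) = (\<Sum>i<n. \<Sum>x\<in>A. f x $$ (i, i))" by (simp add: mat_trace_def)
  also have "\<dots> = (\<Sum>x\<in>A. \<Sum>i<n. f x $$ (i, i))" by (rule sum.swap)
  also have "\<dots> = (\<Sum>x\<in>A. mat_trace (f x))"
    using assms by (intro sum.cong) (auto simp: mat_trace_def)
  finally show ?thesis .
qed

text \<open>
  Summation over the group turns an arbitrary matrix \<open>A\<close> into one that commutes with the two group actions.
\<close>

definition intertwiner ::
  "('a, 'b) monoid_scheme \<Rightarrow> nat \<Rightarrow> nat \<Rightarrow> ('a \<Rightarrow> complex mat) \<Rightarrow> ('a \<Rightarrow> complex mat) \<Rightarrow> complex mat \<Rightarrow> complex mat" where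
  "intertwiner G n m \<rho> \<sigma> A = mat_sum n m (\<lambda>y. \<rho> y * A * \<sigma> (inv\<^bsub>G\<^esub> y)) (carrier G)"

lemma intertwiner_carrier [simp]: "intertwiner G n m \<rho> \<sigma> A \<in> carrier_mat n m"
  by (simp add: intertwiner_def)

lemma intertwiner_commutes:
  fixes G (structure)
  assumes G: "group G" and r: "representation G n \<rho>" and s: "representation G m \<sigma>"
    and A: "A \<in> carrier_mat n m" and z: "z \<in> carrier G"
  shows "\<rho> z * intertwiner G n m \<rho> \<sigma> A = intertwiner G n m \<rho> \<sigma> A * \<sigma> z"
proof -
  interpret group G by fact
  note R = representationD[OF G r] and S = representationD[OF G s]
  have c: "\<rho> y * A * \<sigma> (inv y) \<in> carrier_mat n m" if "y \<in> carrier G" for y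
    using R(2)[OF that] S(2)[of "inv y"] that A by auto
  have bij: "bij_betw (\<lambda>y. z \<otimes> y) (carrier G) (carrier G)"
    using z by (intro bij_betwI[where g = "\<lambda>y. inv z \<otimes> y"]) (auto simp: m_assoc[symmetric])
  have "\<rho> z * intertwiner G n m \<rho> \<sigma> A = mat_sum n m (\<lambda>y. \<rho> z * (\<rho> y * A * \<sigma> (inv y))) (carrier G)"
    unfolding intertwiner_def by (rule mult_mat_sum[OF R(2)[OF z] c])
  also have "\<dots> = mat_sum n m (\<lambda>y. \<rho> (z \<otimes> y) * A * \<sigma> (inv (z \<otimes> y)) * \<sigma> z) (carrier G)"
  proof (rule mat_sum_cong)
    fix y assume y: "y \<in> carrier G"
    have iy: "inv y = inv (z \<otimes> y) \<otimes> z" using y z by (simp add: inv_mult_group m_assoc)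
    have "\<sigma> (inv y) = \<sigma> (inv (z \<otimes> y)) * \<sigma> z" unfolding iy using y z by (intro S(4)) auto
    moreover have "\<rho> (z \<otimes> y) = \<rho> z * \<rho> y" using y z by (rule R(4)[rotated])
    moreover note d = carrier_matD[OF R(2)[OF z]] carrier_matD[OF R(2)[OF y]] carrier_matD[OF A]
      carrier_matD[OF S(2)[OF z]] carrier_matD[OF S(2)[of "inv (z \<otimes> y)"]]
    ultimately show "\<rho> z * (\<rho> y * A * \<sigma> (inv y)) = \<rho> (z \<otimes> y) * A * \<sigma> (inv (z \<otimes> y)) * \<sigma> z"
      using y z by (simp only: mat_assoc_dim index_mult_mat(2,3) m_closed inv_closed)
  qed
  also have "\<dots> = mat_sum n m (\<lambda>y. \<rho> y * A * \<sigma> (inv y) * \<sigma> z) (carrier G)"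
    by (rule mat_sum_reindex[OF bij])
  also have "\<dots> = intertwiner G n m \<rho> \<sigma> A * \<sigma> z"
    unfolding intertwiner_def by (rule mat_sum_mult[OF S(2)[OF z] c, symmetric])
  finally show ?thesis .
qed

text \<open>
  Once the commuting matrix \<open>P\<close> is moved through, every summand of the average is conjugate to
  \<open>P * B\<close>. This trace detects that an average is nonzero and, for \<open>P = 1\<close>, gives the constant in
  Schur orthogonality.
\<close>

lemma mat_trace_intertwiner_mult:
  fixes G (structure)
  assumes G: "group G" and r: "representation G n \<rho>" and s: "representation G m \<sigma>"
    and B: "B \<in> carrier_mat m n" and P: "P \<in> carrier_mat n m"
    and comm: "\<And>z. z \<in> carrier G \<Longrightarrow> \<rho> z * P = P * \<sigma> z"
  shows "mat_trace (P * intertwiner G m n \<sigma> \<rho> B) = of_nat (card (carrier G)) * mat_trace (P * B)"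
proof -
  interpret group G by fact
  note R = representationD[OF G r] and S = representationD[OF G s]
  have c: "\<sigma> y * B * \<rho> (inv y) \<in> carrier_mat m n" if "y \<in> carrier G" for y
    using S(2)[OF that] R(2)[of "inv y"] that B by auto
  have "mat_trace (P * (\<sigma> y * B * \<rho> (inv y))) = mat_trace (P * B)" if y: "y \<in> carrier G" for y
  proof -
    have ry: "\<rho> y \<in> carrier_mat n n" and ri: "\<rho> (inv y) \<in> carrier_mat n n" using R(2) y by auto
    note d = carrier_matD[OF ry] carrier_matD[OF ri] carrier_matD[OF B] carrier_matD[OF P] carrier_matD[OF S(2)[OF y]]
    have "P * (\<sigma> y * B * \<rho> (inv y)) = (P * \<sigma> y) * (B * \<rho> (inv y))"
      by (simp only: mat_assoc_dim index_mult_mat(2,3) d)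
    also have "\<dots> = \<rho> y * (P * B * \<rho> (inv y))"
      unfolding comm[OF y, symmetric] by (simp only: mat_assoc_dim index_mult_mat(2,3) d)
    also have "mat_trace \<dots> = mat_trace (P * B * \<rho> (inv y) * \<rho> y)"
      by (rule mat_trace_commute[of _ n n]) (use ry ri P B in auto)
    also have "P * B * \<rho> (inv y) * \<rho> y = P * B * (\<rho> (inv y) * \<rho> y)"
      by (simp only: mat_assoc_dim index_mult_mat(2,3) d)
    also have "\<rho> (inv y) * \<rho> y = 1\<^sub>m n" using R(3) R(4)[of "inv y" y] y by simp
    also have "P * B * 1\<^sub>m n = P * B" using P B by (intro right_mult_one_mat) auto
    finally show ?thesis .
  qed
  moreover have "P * intertwiner G m n \<sigma> \<rho> B = mat_sum n n (\<lambda>y. P * (\<sigma> y * B * \<rho> (inv y))) (carrier G)"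
    unfolding intertwiner_def by (rule mult_mat_sum[OF P c])
  moreover have "mat_trace (mat_sum n n (\<lambda>y. P * (\<sigma> y * B * \<rho> (inv y))) (carrier G)) =
      (\<Sum>y\<in>carrier G. mat_trace (P * (\<sigma> y * B * \<rho> (inv y))))"
    by (rule mat_trace_mat_sum, rule mult_carrier_mat[OF P c])
  ultimately show ?thesis by simp
qed

definition unit_mat :: "nat \<Rightarrow> nat \<Rightarrow> nat \<Rightarrow> nat \<Rightarrow> complex mat" where
  "unit_mat n m j k = mat n m (\<lambda>(a, b). if a = j \<and> b = k then 1 else 0)"

lemma unit_mat_carrier [simp]: "unit_mat n m j k \<in> carrier_mat n m"
  by (simp add: unit_mat_def)

lemma mult_unit_mat_mult_index:
  assumes M: "M \<in> carrier_mat p n" and N: "N \<in> carrier_mat m q" and jk: "j < n" "k < m" and il: "i < p" "l < q"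
  shows "(M * unit_mat n m j k * N) $$ (i, l) = M $$ (i, j) * N $$ (k, l)"
proof -
  have 1: "(M * unit_mat n m j k) $$ (i, b) = (if b = k then M $$ (i, j) else 0)" if "b < m" for b
  proof -
    have "(M * unit_mat n m j k) $$ (i, b) = (\<Sum>a<n. M $$ (i, a) * unit_mat n m j k $$ (a, b))"
      using M il that by (simp add: unit_mat_def scalar_prod_def atLeast0LessThan)
    also have "\<dots> = (\<Sum>a<n. if a = j then (if b = k then M $$ (i, j) else 0) else 0)"
      using that by (intro sum.cong) (auto simp: unit_mat_def)
    finally show ?thesis using jk by simp
  qed
  have "(M * unit_mat n m j k * N) $$ (i, l) = (\<Sum>b<m. (M * unit_mat n m j k) $$ (i, b) * N $$ (b, l))"
    using M N il by (auto simp: scalar_prod_def atLeast0LessThan unit_mat_def)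
  also have "\<dots> = (\<Sum>b<m. if b = k then M $$ (i, j) * N $$ (k, l) else 0)"
    by (rule sum.cong) (auto simp: 1)
  finally show ?thesis using jk by simp
qed

lemma mat_trace_mult_unit_mat:
  assumes P: "P \<in> carrier_mat n m" and "i < n" "l < m"
  shows "mat_trace (P * unit_mat m n l i) = P $$ (i, l)"
proof -
  have "mat_trace (P * unit_mat m n l i) = (\<Sum>a<n. \<Sum>b<m. P $$ (a, b) * unit_mat m n l i $$ (b, a))"
    by (rule mat_trace_mult[OF P unit_mat_carrier])
  also have "\<dots> = (\<Sum>a<n. if a = i then P $$ (i, l) else 0)"
  proof (rule sum.cong)
    fix a assume "a \<in> {..<n}"
    then have "(\<Sum>b<m. P $$ (a, b) * unit_mat m n l i $$ (b, a)) = (\<Sum>b<m. if b = l then (if a = i then P $$ (i, l) else 0) else 0)"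
      by (intro sum.cong) (auto simp: unit_mat_def)
    then show "(\<Sum>b<m. P $$ (a, b) * unit_mat m n l i $$ (b, a)) = (if a = i then P $$ (i, l) else 0)"
      using assms by simp
  qed simp
  finally show ?thesis using assms by simp
qed

text \<open>
  Let the average \<open>P\<close> be nonzero and let \<open>Q\<close> be an average in the opposite direction with nonzero
  \<open>trace (P Q)\<close>. By Schur's lemma \<open>P Q\<close> and \<open>Q P\<close> are scalar, and \<open>P Q P\<close> shows that the two scalars
  agree. So \<open>P\<close> and \<open>Q\<close> are inverse up to a nonzero scalar, the representations are equivalent and
  their traces coincide.
\<close>

lemma intertwiner_nonzero_imp_same_character:
  fixes G (structure)
  assumes G: "group G" and fin: "finite (carrier G)"
    and ir: "irreducible_representation G n \<rho>" and js: "irreducible_representation G m \<sigma>"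
    and A: "A \<in> carrier_mat n m" and ne: "intertwiner G n m \<rho> \<sigma> A \<noteq> 0\<^sub>m n m"
  shows "afforded_character G n \<rho> = afforded_character G m \<sigma>"
proof -
  interpret group G by fact
  have r: "representation G n \<rho>" and s: "representation G m \<sigma>"
    using ir js by (simp_all add: irreducible_representation_def)
  note R = representationD[OF G r] and S = representationD[OF G s]
  define P where "P = intertwiner G n m \<rho> \<sigma> A"
  have P: "P \<in> carrier_mat n m" by (simp add: P_def)
  have Pc: "\<rho> z * P = P * \<sigma> z" if "z \<in> carrier G" for z
    unfolding P_def by (rule intertwiner_commutes[OF G r s A that])
  have "\<exists>i<n. \<exists>l<m. P $$ (i, l) \<noteq> 0"
  proof (rule ccontr)
    assume "\<not> ?thesis"
    then have "P = 0\<^sub>m n m" using P by (intro eq_matI) auto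
    with ne show False by (simp add: P_def)
  qed
  then obtain i l where i: "i < n" and l: "l < m" and Pil: "P $$ (i, l) \<noteq> 0" by blast
  \<comment> \<open>this matrix unit makes \<open>trace (P Q)\<close> a nonzero multiple of the entry \<open>P $$ (i, l)\<close>\<close>
  define Q where "Q = intertwiner G m n \<sigma> \<rho> (unit_mat m n l i)"
  have Q: "Q \<in> carrier_mat m n" by (simp add: Q_def)
  have Qc: "\<sigma> z * Q = Q * \<rho> z" if "z \<in> carrier G" for z
    unfolding Q_def by (rule intertwiner_commutes[OF G s r _ that]) simp
  have trPQ: "mat_trace (P * Q) \<noteq> 0"
  proof -
    have "mat_trace (P * Q) = of_nat (card (carrier G)) * mat_trace (P * unit_mat m n l i)"
      unfolding Q_def by (rule mat_trace_intertwiner_mult[OF G r s unit_mat_carrier P Pc])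
    then show ?thesis
      unfolding mat_trace_mult_unit_mat[OF P i l] using Pil fin by (auto simp: card_eq_0_iff)
  qed
  note d = carrier_matD[OF P] carrier_matD[OF Q]
  have "\<rho> z * (P * Q) = (P * Q) * \<rho> z" if z: "z \<in> carrier G" for z
  proof -
    note dz = carrier_matD[OF R(2)[OF z]] carrier_matD[OF S(2)[OF z]]
    have "\<rho> z * (P * Q) = (\<rho> z * P) * Q" by (simp only: mat_assoc_dim index_mult_mat(2,3) d dz)
    also have "\<dots> = P * (\<sigma> z * Q)" unfolding Pc[OF z] by (simp only: mat_assoc_dim index_mult_mat(2,3) d dz)
    also have "\<dots> = (P * Q) * \<rho> z" unfolding Qc[OF z] by (simp only: mat_assoc_dim index_mult_mat(2,3) d dz)
    finally show ?thesis .
  qed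
  then obtain \<alpha> where PQ: "P * Q = \<alpha> \<cdot>\<^sub>m 1\<^sub>m n"
    using schur_scalar[OF G ir, of "P * Q"] P Q by auto
  have "\<sigma> z * (Q * P) = (Q * P) * \<sigma> z" if z: "z \<in> carrier G" for z
  proof -
    note dz = carrier_matD[OF R(2)[OF z]] carrier_matD[OF S(2)[OF z]]
    have "\<sigma> z * (Q * P) = (\<sigma> z * Q) * P" by (simp only: mat_assoc_dim index_mult_mat(2,3) d dz)
    also have "\<dots> = Q * (\<rho> z * P)" unfolding Qc[OF z] by (simp only: mat_assoc_dim index_mult_mat(2,3) d dz)
    also have "\<dots> = (Q * P) * \<sigma> z" unfolding Pc[OF z] by (simp only: mat_assoc_dim index_mult_mat(2,3) d dz)
    finally show ?thesis .
  qed
  then obtain \<beta> where QP: "Q * P = \<beta> \<cdot>\<^sub>m 1\<^sub>m m"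
    using schur_scalar[OF G js, of "Q * P"] P Q by auto
  have \<alpha>0: "\<alpha> \<noteq> 0" using trPQ by (auto simp: PQ mat_trace_smult[of _ n])
  have scal: "(c \<cdot>\<^sub>m 1\<^sub>m a) * M = c \<cdot>\<^sub>m M" "M * (c \<cdot>\<^sub>m 1\<^sub>m b) = c \<cdot>\<^sub>m M"
    if "M \<in> carrier_mat a b" for c and M :: "complex mat" and a b
    using that by (auto simp: mult_smult_assoc_mat[of _ a a] mult_smult_distrib[of _ a b])
  have "\<alpha> \<cdot>\<^sub>m P = P * Q * P" unfolding PQ using scal(1)[OF P] by simp
  also have "\<dots> = P * (Q * P)" by (simp only: mat_assoc_dim index_mult_mat(2,3) d)
  also have "\<dots> = \<beta> \<cdot>\<^sub>m P" unfolding QP by (rule scal(2)[OF P])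
  finally have "(\<alpha> \<cdot>\<^sub>m P) $$ (i, l) = (\<beta> \<cdot>\<^sub>m P) $$ (i, l)" by simp
  then have \<beta>: "\<beta> = \<alpha>" using Pil P i l by simp
  have "mat_trace (\<rho> z) = mat_trace (\<sigma> z)" if z: "z \<in> carrier G" for z
  proof -
    have rz: "\<rho> z \<in> carrier_mat n n" and sz: "\<sigma> z \<in> carrier_mat m m" using R(2) S(2) z by auto
    note dz = carrier_matD[OF rz] carrier_matD[OF sz]
    have "\<alpha> * mat_trace (\<rho> z) = mat_trace (\<rho> z * (P * Q))"
      unfolding PQ scal(2)[OF rz] by (rule mat_trace_smult[OF rz, symmetric])
    also have "\<rho> z * (P * Q) = (\<rho> z * P) * Q" by (simp only: mat_assoc_dim index_mult_mat(2,3) d dz)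
    also have "\<dots> = P * (\<sigma> z * Q)" unfolding Pc[OF z] by (simp only: mat_assoc_dim index_mult_mat(2,3) d dz)
    also have "mat_trace \<dots> = mat_trace (\<sigma> z * Q * P)"
      by (rule mat_trace_commute[of _ n m]) (use P Q sz in auto)
    also have "\<sigma> z * Q * P = \<sigma> z * (Q * P)" by (simp only: mat_assoc_dim index_mult_mat(2,3) d dz)
    also have "mat_trace \<dots> = \<alpha> * mat_trace (\<sigma> z)"
      unfolding QP scal(2)[OF sz] \<beta> by (rule mat_trace_smult[OF sz])
    finally show ?thesis using \<alpha>0 by simp
  qed
  then show ?thesis
    by (intro extensionalityI[of _ "carrier G"])
       (simp_all add: afforded_character_eq[OF G r] afforded_character_eq[OF G s], simp_all add: afforded_character_def)
qed

definition conv :: "('a, 'b) monoid_scheme \<Rightarrow> ('a \<Rightarrow> complex) \<Rightarrow> ('a \<Rightarrow> complex) \<Rightarrow> 'a \<Rightarrow> complex" where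
  "conv G f h x = (\<Sum>y\<in>carrier G. f y * h (inv\<^bsub>G\<^esub> y \<otimes>\<^bsub>G\<^esub> x))"

text \<open>
  Averages of matrix units have the sums \<open>\<Sum>y. \<rho> y $$ (i, i) * \<sigma> (inv y) $$ (k, l)\<close> as entries, so
  Schur's lemma computes convolutions of irreducible characters.
\<close>

lemma conv_afforded_characters:
  fixes G (structure)
  assumes G: "group G" and r: "representation G n \<rho>" and s: "representation G m \<sigma>" and x: "x \<in> carrier G"
  shows "conv G (afforded_character G n \<rho>) (afforded_character G m \<sigma>) x =
    (\<Sum>i<n. \<Sum>k<m. \<Sum>l<m. intertwiner G n m \<rho> \<sigma> (unit_mat n m i k) $$ (i, l) * \<sigma> x $$ (l, k))"
proof -
  interpret group G by fact
  note R = representationD[OF G r] and S = representationD[OF G s]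
  have "conv G (afforded_character G n \<rho>) (afforded_character G m \<sigma>) x =
    (\<Sum>y\<in>carrier G. \<Sum>i<n. \<Sum>k<m. \<Sum>l<m. \<rho> y $$ (i, i) * \<sigma> (inv y) $$ (k, l) * \<sigma> x $$ (l, k))"
    unfolding conv_def
  proof (rule sum.cong)
    fix y assume y: "y \<in> carrier G"
    have "afforded_character G m \<sigma> (inv y \<otimes> x) = mat_trace (\<sigma> (inv y) * \<sigma> x)"
      using x y by (simp add: afforded_character_eq[OF G s] S(4))
    also have "\<dots> = (\<Sum>k<m. \<Sum>l<m. \<sigma> (inv y) $$ (k, l) * \<sigma> x $$ (l, k))"
      by (rule mat_trace_mult) (use S(2) x y in auto)
    finally have 1: "afforded_character G m \<sigma> (inv y \<otimes> x) = (\<Sum>k<m. \<Sum>l<m. \<sigma> (inv y) $$ (k, l) * \<sigma> x $$ (l, k))" .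
    show "afforded_character G n \<rho> y * afforded_character G m \<sigma> (inv y \<otimes> x) =
      (\<Sum>i<n. \<Sum>k<m. \<Sum>l<m. \<rho> y $$ (i, i) * \<sigma> (inv y) $$ (k, l) * \<sigma> x $$ (l, k))"
    proof -
      have "afforded_character G n \<rho> y = (\<Sum>i<n. \<rho> y $$ (i, i))" using y by (simp add: afforded_character_def)
      then show ?thesis unfolding 1 by (simp only: sum_distrib_right) (simp only: sum_distrib_left mult.assoc)
    qed
  qed simp
  also have "\<dots> = (\<Sum>i<n. \<Sum>k<m. \<Sum>l<m. \<Sum>y\<in>carrier G. \<rho> y $$ (i, i) * \<sigma> (inv y) $$ (k, l) * \<sigma> x $$ (l, k))"
    by (simp only: sum.swap[of _ _ "carrier G"])
  also have "\<dots> = (\<Sum>i<n. \<Sum>k<m. \<Sum>l<m. intertwiner G n m \<rho> \<sigma> (unit_mat n m i k) $$ (i, l) * \<sigma> x $$ (l, k))"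
  proof (intro sum.cong refl)
    fix i k l assume "i \<in> {..<n}" "k \<in> {..<m}" "l \<in> {..<m}"
    then have ikl: "i < n" "k < m" "l < m" by auto
    have "intertwiner G n m \<rho> \<sigma> (unit_mat n m i k) $$ (i, l) = (\<Sum>y\<in>carrier G. \<rho> y $$ (i, i) * \<sigma> (inv y) $$ (k, l))"
      unfolding intertwiner_def mat_sum_index[OF ikl(1,3)]
      by (intro sum.cong refl mult_unit_mat_mult_index) (use R(2) S(2) ikl in auto)
    then show "(\<Sum>y\<in>carrier G. \<rho> y $$ (i, i) * \<sigma> (inv y) $$ (k, l) * \<sigma> x $$ (l, k))
        = intertwiner G n m \<rho> \<sigma> (unit_mat n m i k) $$ (i, l) * \<sigma> x $$ (l, k)"
      by (simp add: sum_distrib_right)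
  qed
  finally show ?thesis .
qed

lemma conv_distinct_irreducible_characters:
  assumes G: "group G" and fin: "finite (carrier G)"
    and \<chi>: "\<chi> \<in> Irr G" and \<psi>: "\<psi> \<in> Irr G" and ne: "\<chi> \<noteq> \<psi>" and x: "x \<in> carrier G"
  shows "conv G \<chi> \<psi> x = 0"
proof -
  obtain n \<rho> where ir: "irreducible_representation G n \<rho>" and \<chi>': "\<chi> = afforded_character G n \<rho>"
    using \<chi> by (auto simp: Irr_def)
  obtain m \<sigma> where js: "irreducible_representation G m \<sigma>" and \<psi>': "\<psi> = afforded_character G m \<sigma>"
    using \<psi> by (auto simp: Irr_def)
  have r: "representation G n \<rho>" and s: "representation G m \<sigma>"
    using ir js by (simp_all add: irreducible_representation_def)
  have "intertwiner G n m \<rho> \<sigma> (unit_mat n m i k) = 0\<^sub>m n m" for i k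
    using intertwiner_nonzero_imp_same_character[OF G fin ir js unit_mat_carrier] ne \<chi>' \<psi>' by blast
  then show ?thesis
    unfolding \<chi>' \<psi>' conv_afforded_characters[OF G r s x] by simp
qed

text \<open>
  The constant is \<open>card (carrier G) / n\<close>, where \<open>n\<close> is the degree.
\<close>

lemma conv_irreducible_character_self:
  assumes G: "group G" and fin: "finite (carrier G)" and \<chi>: "\<chi> \<in> Irr G"
  obtains c where "c \<noteq> 0" "\<And>x. x \<in> carrier G \<Longrightarrow> conv G \<chi> \<chi> x = c * \<chi> x"
proof -
  obtain n \<rho> where ir: "irreducible_representation G n \<rho>" and \<chi>': "\<chi> = afforded_character G n \<rho>"
    using \<chi> by (auto simp: Irr_def)
  have r: "representation G n \<rho>" using ir by (simp add: irreducible_representation_def)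
  note R = representationD[OF G r]
  interpret group G by fact
  define c where "c = of_nat (card (carrier G)) / (of_nat n :: complex)"
  have c0: "c \<noteq> 0" using fin R(1) by (auto simp: c_def card_eq_0_iff)
  have I: "intertwiner G n n \<rho> \<rho> (unit_mat n n i k) = (if i = k then c else 0) \<cdot>\<^sub>m 1\<^sub>m n"
    if ik: "i < n" "k < n" for i k
  proof -
    let ?P = "intertwiner G n n \<rho> \<rho> (unit_mat n n i k)"
    obtain a where a: "?P = a \<cdot>\<^sub>m 1\<^sub>m n"
      by (rule schur_scalar[OF G ir intertwiner_carrier intertwiner_commutes[OF G r r unit_mat_carrier]])
    have "a * of_nat n = mat_trace ?P" unfolding a by (simp add: mat_trace_smult[of _ n] mat_trace_one)
    also have "?P = 1\<^sub>m n * ?P" by (rule left_mult_one_mat[OF intertwiner_carrier, symmetric])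
    also have "mat_trace \<dots> = of_nat (card (carrier G)) * mat_trace (1\<^sub>m n * unit_mat n n i k)"
      by (rule mat_trace_intertwiner_mult[OF G r r])
         (simp_all add: left_mult_one_mat[OF R(2)] right_mult_one_mat[OF R(2)])
    also have "mat_trace (1\<^sub>m n * unit_mat n n i k) = (if i = k then 1 else 0)"
      using mat_trace_mult_unit_mat[of "1\<^sub>m n" n n k i] ik by simp
    finally have "a = (if i = k then c else 0)" using R(1) by (auto simp: c_def field_simps)
    with a show ?thesis by simp
  qed
  have "conv G \<chi> \<chi> x = c * \<chi> x" if x: "x \<in> carrier G" for x
  proof -
    have "conv G \<chi> \<chi> x = (\<Sum>i<n. \<Sum>k<n. \<Sum>l<n. (if l = i then (if k = i then c * \<rho> x $$ (i, i) else 0) else 0))"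
      unfolding \<chi>' conv_afforded_characters[OF G r r x] by (intro sum.cong refl) (auto simp: I)
    also have "\<dots> = (\<Sum>i<n. c * \<rho> x $$ (i, i))" by simp
    finally show ?thesis using x by (simp add: \<chi>' afforded_character_def sum_distrib_left)
  qed
  then show ?thesis using that c0 by blast
qed

section \<open>Functions constant on superclasses\<close>

lemma sum_fun_apply: "(\<Sum>i\<in>A. f i) k = (\<Sum>i\<in>A. f i k)" for f :: "'i \<Rightarrow> 'k \<Rightarrow> complex"
  by (induction A rule: infinite_finite_induct) simp_all

text \<open>
  The functions on \<open>K\<close> form a space of dimension \<open>card K\<close>, in which as many independent functions
  span. Independence is required of the family \<open>f\<close>, so it includes that \<open>f\<close> is injective on \<open>I\<close>.
\<close>

lemma independent_functions_span:
  fixes f :: "'i \<Rightarrow> 'k \<Rightarrow> complex"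
  assumes I: "finite I" and K: "finite K" and card: "card I = card K"
    and ind: "\<And>c. (\<And>k. k \<in> K \<Longrightarrow> (\<Sum>i\<in>I. c i * f i k) = 0) \<Longrightarrow> \<forall>i\<in>I. c i = 0"
  shows "\<exists>c. \<forall>k\<in>K. h k = (\<Sum>i\<in>I. c i * f i k)"
proof -
  interpret vs: vector_space "\<lambda>c (f :: 'k \<Rightarrow> complex) k. c * f k"
    by unfold_locales (auto simp: fun_eq_iff algebra_simps)
  \<comment> \<open>functions on \<open>K\<close> become functions on the whole type that vanish outside \<open>K\<close>; the functions
    \<open>D l\<close> with \<open>l \<in> K\<close> span the space of these\<close>
  define F where "F i = (\<lambda>k. if k \<in> K then f i k else 0)" for i
  define D where "D l = (\<lambda>k. if k = l then 1 else 0 :: complex)" for l :: 'k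
  have inD: "u \<in> vs.span (D ` K)" if u: "\<And>k. k \<notin> K \<Longrightarrow> u k = 0" for u
  proof -
    have "u = (\<Sum>l\<in>K. (\<lambda>k. u l * D l k))"
    proof
      fix k
      have "(\<Sum>l\<in>K. (\<lambda>k. u l * D l k)) k = (\<Sum>l\<in>K. if l = k then u k else 0)"
        by (subst sum_fun_apply) (auto simp: D_def intro!: sum.cong)
      then show "u k = (\<Sum>l\<in>K. (\<lambda>k. u l * D l k)) k" using K u by auto
    qed
    also have "\<dots> \<in> vs.span (D ` K)"
      by (intro vs.span_sum vs.span_scale vs.span_base) auto
    finally show ?thesis .
  qed
  have Fzero: "\<forall>i\<in>I. c i = 0" if "(\<Sum>i\<in>I. (\<lambda>k. c i * F i k)) = 0" for c
  proof (rule ind)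
    fix k assume k: "k \<in> K"
    have "(\<Sum>i\<in>I. c i * F i k) = 0" using fun_cong[OF that, of k] by (simp add: sum_fun_apply)
    then show "(\<Sum>i\<in>I. c i * f i k) = 0" using k by (simp add: F_def)
  qed
  have inj: "inj_on F I"
  proof (rule inj_onI, rule ccontr)
    fix i j assume ij: "i \<in> I" "j \<in> I" "F i = F j" "i \<noteq> j"
    let ?c = "\<lambda>x. if x = i then 1 else if x = j then -1 else 0 :: complex"
    have "(\<Sum>x\<in>I. (\<lambda>k. ?c x * F x k)) = 0"
    proof
      fix k
      have "(\<Sum>x\<in>I. ?c x * F x k) = (\<Sum>x\<in>I. (if x = i then F i k else 0) - (if x = j then F j k else 0))"
        by (rule sum.cong) (use ij in auto)
      also have "\<dots> = 0" using ij I by (simp add: sum_subtractf)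
      finally show "(\<Sum>x\<in>I. (\<lambda>k. ?c x * F x k)) k = 0 k" by (simp add: sum_fun_apply)
    qed
    from Fzero[OF this] ij show False by auto
  qed
  have indep: "vs.independent (F ` I)"
  proof
    assume "vs.dependent (F ` I)"
    then obtain u where u: "\<exists>v\<in>F ` I. u v \<noteq> 0" "(\<Sum>v\<in>F ` I. (\<lambda>k. u v * v k)) = 0"
      using vs.dependent_finite[of "F ` I"] I by auto
    have "(\<Sum>i\<in>I. (\<lambda>k. u (F i) * F i k)) = 0" using u(2) by (simp add: sum.reindex[OF inj])
    from Fzero[OF this] u(1) show False by auto
  qed
  define h' where "h' = (\<lambda>k. if k \<in> K then h k else 0)"
  have "h' \<in> vs.span (F ` I)"
  proof (rule ccontr)
    assume n: "h' \<notin> vs.span (F ` I)"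
    then have n': "h' \<notin> F ` I" using vs.span_base by blast
    have "vs.independent (insert h' (F ` I))" using indep n vs.independent_insert[of h' "F ` I"] n' by simp
    moreover have "insert h' (F ` I) \<subseteq> vs.span (D ` K)"
      using inD by (auto simp: h'_def F_def)
    ultimately have "card (insert h' (F ` I)) \<le> card (D ` K)"
      using vs.independent_span_bound[of "D ` K" "insert h' (F ` I)"] K by simp
    also have "\<dots> \<le> card K" by (rule card_image_le[OF K])
    finally show False using n' I card by (simp add: card_image[OF inj])
  qed
  then obtain u where u: "h' = (\<Sum>v\<in>F ` I. (\<lambda>k. u v * v k))"
    using vs.span_finite[of "F ` I"] I by auto
  have "h k = (\<Sum>i\<in>I. u (F i) * f i k)" if k: "k \<in> K" for k
  proof -
    have "h' k = (\<Sum>i\<in>I. u (F i) * F i k)"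
      using fun_cong[OF u, of k] by (simp add: sum_fun_apply sum.reindex[OF inj])
    then show ?thesis using k by (simp add: h'_def F_def)
  qed
  then show ?thesis by (intro exI[of _ "\<lambda>i. u (F i)"] ballI)
qed

lemma conv_cong:
  assumes "group G" "x \<in> carrier G" "\<And>y. y \<in> carrier G \<Longrightarrow> f y = f' y" "\<And>y. y \<in> carrier G \<Longrightarrow> h y = h' y"
  shows "conv G f h x = conv G f' h' x"
proof -
  interpret group G by fact
  show ?thesis unfolding conv_def using assms by (intro sum.cong) auto
qed

lemma conv_sum_left: "conv G (\<lambda>y. \<Sum>i\<in>A. c i * f i y) h x = (\<Sum>i\<in>A. c i * conv G (f i) h x)"
  unfolding conv_def by (simp add: sum_distrib_left sum_distrib_right mult.assoc) (rule sum.swap)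

lemma conv_sum_right: "conv G f (\<lambda>y. \<Sum>i\<in>A. c i * h i y) x = (\<Sum>i\<in>A. c i * conv G f (h i) x)"
  unfolding conv_def by (simp add: sum_distrib_left mult.left_commute) (rule sum.swap)

lemma conv_delta:
  fixes G (structure)
  assumes G: "group G" and fin: "finite (carrier G)" and x: "x \<in> carrier G"
  shows "conv G f (\<lambda>y. if y = \<one> then 1 else 0) x = f x"
proof -
  interpret group G by fact
  have eq: "inv y \<otimes> x = \<one> \<longleftrightarrow> x = y" if y: "y \<in> carrier G" for y
  proof
    assume e: "inv y \<otimes> x = \<one>"
    have "x = y \<otimes> (inv y \<otimes> x)" using x y by (simp add: m_assoc[symmetric])
    also have "\<dots> = y" unfolding e using y by simp
    finally show "x = y" .
  qed (use y in simp)
  have "conv G f (\<lambda>y. if y = \<one> then 1 else 0) x = (\<Sum>y\<in>carrier G. if x = y then f x else 0)"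
    unfolding conv_def by (rule sum.cong) (auto simp: eq)
  then show ?thesis using fin x by simp
qed

definition superclass_function :: "'a supercharacter_pair \<Rightarrow> ('a \<Rightarrow> complex) \<Rightarrow> bool" where
  "superclass_function S f \<longleftrightarrow> (\<forall>K\<in>Cl S. \<forall>g\<in>K. \<forall>h\<in>K. f g = f h)"

lemma superclass_functionD:
  assumes "superclass_function S f" and K: "K \<in> Cl S" and g: "g \<in> K" and h: "h \<in> K"
  shows "f g = f h"
proof -
  have "\<forall>g\<in>K. \<forall>h\<in>K. f g = f h" using assms(1)[unfolded superclass_function_def] K by (rule bspec)
  then have "\<forall>h\<in>K. f g = f h" using g by (rule bspec)
  then show ?thesis using h by (rule bspec)
qed

text \<open>
  The characters \<open>\<xi> X\<close> have disjoint sets of irreducible constituents for different \<open>X\<close>, so their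
  convolutions vanish. Convolving a linear relation with a constituent of \<open>\<xi> X\<close> isolates the
  coefficient at \<open>X\<close>, so they are linearly independent. There are as many of them as superclasses,
  hence they span the functions that are constant on superclasses.
\<close>

lemma supercharacter_basis:
  assumes G: "group G" and fin: "finite (carrier G)" and S: "supercharacter_theory G S"
  obtains \<xi> where "finite (fst S)"
    "\<forall>X\<in>fst S. is_character G (\<xi> X)"
    "\<forall>X\<in>fst S. superclass_function S (\<xi> X)"
    "\<forall>X\<in>fst S. \<forall>Y\<in>fst S. X \<noteq> Y \<longrightarrow> (\<forall>x\<in>carrier G. conv G (\<xi> X) (\<xi> Y) x = 0)"
    "\<forall>h. superclass_function S h \<longrightarrow> (\<exists>c. \<forall>x\<in>carrier G. h x = (\<Sum>X\<in>fst S. c X * \<xi> X x))"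
proof -
  interpret group G by fact
  have pX: "partition_on (Irr G) (fst S)" and pK: "partition_on (carrier G) (Cl S)"
    and card: "card (Cl S) = card (fst S)"
    using S by (auto simp: supercharacter_theory_def)
  have finK: "finite (Cl S)" by (rule finite_elements[OF fin pK])
  have neK: "Cl S \<noteq> {}" using S by (auto simp: supercharacter_theory_def)
  have finX: "finite (fst S)" using card finK neK by (metis card_eq_0_iff)
  have "\<forall>X\<in>fst S. \<exists>\<xi>. is_character G \<xi> \<and> irr_constituents G \<xi> \<subseteq> X \<and> superclass_function S \<xi>"
    using S by (simp add: supercharacter_theory_def superclass_function_def)
  from bchoice[OF this] obtain \<xi> where
    \<xi>: "\<forall>X\<in>fst S. is_character G (\<xi> X) \<and> irr_constituents G (\<xi> X) \<subseteq> X \<and> superclass_function S (\<xi> X)" ..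
  then have ch: "is_character G (\<xi> X)" and ic: "irr_constituents G (\<xi> X) \<subseteq> X"
    and sc: "superclass_function S (\<xi> X)" if "X \<in> fst S" for X using that by auto
  have "\<forall>X\<in>fst S. \<exists>p. finite (fst p) \<and> fst p \<subseteq> X \<and> (\<forall>g\<in>carrier G. \<xi> X g = (\<Sum>\<chi>\<in>fst p. snd p \<chi> * \<chi> g))"
  proof
    fix X assume X: "X \<in> fst S"
    obtain F a where F: "finite F" "F \<subseteq> irr_constituents G (\<xi> X)"
      and Fa: "\<And>g. g \<in> carrier G \<Longrightarrow> \<xi> X g = (\<Sum>\<chi>\<in>F. a \<chi> * \<chi> g)"
      by (rule character_decomposition[OF G ch[OF X]]) blast
    have "finite (fst (F, a)) \<and> fst (F, a) \<subseteq> X \<and> (\<forall>g\<in>carrier G. \<xi> X g = (\<Sum>\<chi>\<in>fst (F, a). snd (F, a) \<chi> * \<chi> g))"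
      using F ic[OF X] Fa by simp
    then show "\<exists>p. finite (fst p) \<and> fst p \<subseteq> X \<and> (\<forall>g\<in>carrier G. \<xi> X g = (\<Sum>\<chi>\<in>fst p. snd p \<chi> * \<chi> g))"
      by (rule exI)
  qed
  from bchoice[OF this] obtain q where
    q: "\<forall>X\<in>fst S. finite (fst (q X)) \<and> fst (q X) \<subseteq> X \<and> (\<forall>g\<in>carrier G. \<xi> X g = (\<Sum>\<chi>\<in>fst (q X). snd (q X) \<chi> * \<chi> g))" ..
  define F where "F X = fst (q X)" for X
  define a where "a X = snd (q X)" for X
  have F: "finite (F X)" "F X \<subseteq> X" and Fa: "g \<in> carrier G \<Longrightarrow> \<xi> X g = (\<Sum>\<chi>\<in>F X. a X \<chi> * \<chi> g)"
    if "X \<in> fst S" for X g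
    using q that unfolding F_def a_def by blast+
  have irr: "\<chi> \<in> Irr G" if "X \<in> fst S" "\<chi> \<in> F X" for X \<chi>
    using that F(2) partition_onD1[OF pX] by blast
  have disj: "\<chi> \<noteq> \<psi>" if "X \<in> fst S" "Y \<in> fst S" "X \<noteq> Y" "\<chi> \<in> F X" "\<psi> \<in> F Y" for X Y \<chi> \<psi>
  proof
    assume "\<chi> = \<psi>"
    then have "\<psi> \<in> X \<inter> Y" using that(4,5) F(2)[OF that(1)] F(2)[OF that(2)] by auto
    then show False using disjointD[OF partition_onD2[OF pX] that(1-3)] by simp
  qed
  have conv_irr: "conv G \<chi> (\<xi> X) x = (\<Sum>\<psi>\<in>F X. a X \<psi> * conv G \<chi> \<psi> x)"
    if "X \<in> fst S" "x \<in> carrier G" for X \<chi> x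
  proof -
    have "conv G \<chi> (\<xi> X) x = conv G \<chi> (\<lambda>g. \<Sum>\<psi>\<in>F X. a X \<psi> * \<psi> g) x"
      by (rule conv_cong[OF G that(2)]) (auto simp: Fa that)
    then show ?thesis by (simp add: conv_sum_right)
  qed
  have conv_other: "conv G \<chi> (\<xi> Y) x = 0"
    if "X \<in> fst S" "Y \<in> fst S" "X \<noteq> Y" "\<chi> \<in> F X" "x \<in> carrier G" for X Y \<chi> x
    unfolding conv_irr[OF that(2,5)]
  proof (rule sum.neutral, rule ballI)
    fix \<psi> assume "\<psi> \<in> F Y"
    then show "a Y \<psi> * conv G \<chi> \<psi> x = 0"
      using conv_distinct_irreducible_characters[OF G fin irr[OF that(1,4)] irr[OF that(2)] disj[OF that(1-4)] that(5)]
      by simp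
  qed
  have orth: "conv G (\<xi> X) (\<xi> Y) x = 0" if "X \<in> fst S" "Y \<in> fst S" "X \<noteq> Y" "x \<in> carrier G" for X Y x
  proof -
    have "conv G (\<xi> X) (\<xi> Y) x = conv G (\<lambda>g. \<Sum>\<chi>\<in>F X. a X \<chi> * \<chi> g) (\<xi> Y) x"
      by (rule conv_cong[OF G that(4)]) (auto simp: Fa that)
    also have "\<dots> = (\<Sum>\<chi>\<in>F X. a X \<chi> * conv G \<chi> (\<xi> Y) x)" by (rule conv_sum_left)
    also have "\<dots> = 0" using conv_other[OF that(1-3) _ that(4)] by simp
    finally show ?thesis .
  qed
  have ind: "\<forall>X\<in>fst S. c X = 0" if zero: "\<And>g. g \<in> carrier G \<Longrightarrow> (\<Sum>X\<in>fst S. c X * \<xi> X g) = 0" for c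
  proof
    fix X assume X: "X \<in> fst S"
    have "\<exists>\<chi>\<in>F X. a X \<chi> \<noteq> 0"
    proof (rule ccontr)
      assume "\<not> ?thesis"
      then have "\<xi> X \<one>\<^bsub>G\<^esub> = 0" using Fa[OF X one_closed] by simp
      with character_one_nonzero[OF G ch[OF X]] show False by simp
    qed
    then obtain \<chi> where \<chi>: "\<chi> \<in> F X" "a X \<chi> \<noteq> 0" by blast
    obtain b where b: "b \<noteq> 0" "\<And>x. x \<in> carrier G \<Longrightarrow> conv G \<chi> \<chi> x = b * \<chi> x"
      by (rule conv_irreducible_character_self[OF G fin irr[OF X \<chi>(1)]]) blast
    have one: "\<one>\<^bsub>G\<^esub> \<in> carrier G" by simp
    have self: "conv G \<chi> (\<xi> X) \<one>\<^bsub>G\<^esub> = a X \<chi> * (b * \<chi> \<one>\<^bsub>G\<^esub>)"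
    proof -
      have "conv G \<chi> (\<xi> X) \<one>\<^bsub>G\<^esub> = (\<Sum>\<psi>\<in>F X. if \<psi> = \<chi> then a X \<chi> * (b * \<chi> \<one>\<^bsub>G\<^esub>) else 0)"
        unfolding conv_irr[OF X one]
        by (rule sum.cong)
           (auto simp: b(2) intro: conv_distinct_irreducible_characters[OF G fin irr[OF X \<chi>(1)] irr[OF X]])
      then show ?thesis using F(1)[OF X] \<chi>(1) by simp
    qed
    have "0 = conv G \<chi> (\<lambda>g. \<Sum>Y\<in>fst S. c Y * \<xi> Y g) \<one>\<^bsub>G\<^esub>"
      unfolding conv_def using zero by simp
    also have "\<dots> = (\<Sum>Y\<in>fst S. c Y * conv G \<chi> (\<xi> Y) \<one>\<^bsub>G\<^esub>)" by (rule conv_sum_right)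
    also have "\<dots> = (\<Sum>Y\<in>fst S. if Y = X then c X * conv G \<chi> (\<xi> X) \<one>\<^bsub>G\<^esub> else 0)"
      by (rule sum.cong) (use conv_other[OF X _ _ \<chi>(1) one] in auto)
    also have "\<dots> = c X * (a X \<chi> * (b * \<chi> \<one>\<^bsub>G\<^esub>))" using finX X by (simp add: self)
    finally show "c X = 0"
      using \<chi>(2) b(1) character_one_nonzero[OF G Irr_is_character[OF irr[OF X \<chi>(1)]]] by simp
  qed
  have span: "\<exists>c. \<forall>x\<in>carrier G. h x = (\<Sum>X\<in>fst S. c X * \<xi> X x)" if h: "superclass_function S h" for h
  proof -
    \<comment> \<open>a function that is constant on superclasses is determined by its values at representatives\<close>
    define p where "p K = (SOME x. x \<in> K)" for K :: "'a set"
    have pin: "p K \<in> K" if "K \<in> Cl S" for K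
    proof -
      have "K \<noteq> {}" using that partition_onD3[OF pK] by auto
      then show ?thesis unfolding p_def by (simp add: some_in_eq)
    qed
    have const: "f x = f (p K)" if "superclass_function S f" "K \<in> Cl S" "x \<in> K" for f :: "'a \<Rightarrow> complex" and K x
      using that pin[OF that(2)] by (rule superclass_functionD)
    have cover: "\<exists>K\<in>Cl S. x \<in> K" if "x \<in> carrier G" for x
      using that partition_onD1[OF pK] by blast
    have "\<exists>c. \<forall>K\<in>Cl S. h (p K) = (\<Sum>X\<in>fst S. c X * \<xi> X (p K))"
    proof (rule independent_functions_span[OF finX finK card[symmetric]])
      fix c assume z: "\<And>K. K \<in> Cl S \<Longrightarrow> (\<Sum>X\<in>fst S. c X * \<xi> X (p K)) = 0"
      show "\<forall>X\<in>fst S. c X = 0"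
      proof (rule ind)
        fix g assume "g \<in> carrier G"
        then obtain K where K: "K \<in> Cl S" "g \<in> K" using cover by blast
        have "(\<Sum>X\<in>fst S. c X * \<xi> X g) = (\<Sum>X\<in>fst S. c X * \<xi> X (p K))"
          by (rule sum.cong) (simp_all add: const[OF sc K])
        then show "(\<Sum>X\<in>fst S. c X * \<xi> X g) = 0" using z[OF K(1)] by simp
      qed
    qed
    then obtain c where c: "\<forall>K\<in>Cl S. h (p K) = (\<Sum>X\<in>fst S. c X * \<xi> X (p K))" ..
    have "h x = (\<Sum>X\<in>fst S. c X * \<xi> X x)" if x: "x \<in> carrier G" for x
    proof -
      obtain K where K: "K \<in> Cl S" "x \<in> K" using cover[OF x] by blast
      have "(\<Sum>X\<in>fst S. c X * \<xi> X x) = (\<Sum>X\<in>fst S. c X * \<xi> X (p K))"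
        by (rule sum.cong) (simp_all add: const[OF sc K])
      then show ?thesis using bspec[OF c K(1)] const[OF h K] by simp
    qed
    then show ?thesis by (intro exI[of _ c] ballI)
  qed
  show ?thesis
    by (rule that[of \<xi>]) (intro ballI allI impI finX ch sc orth span; assumption)+
qed

lemma superclass_function_conjugation_invariant:
  fixes G (structure)
  assumes G: "group G" and fin: "finite (carrier G)" and S: "supercharacter_theory G S"
    and h: "superclass_function S h" and x: "x \<in> carrier G" and y: "y \<in> carrier G"
  shows "h (y \<otimes> x \<otimes> inv y) = h x"
proof -
  interpret group G by fact
  obtain \<xi> where ch: "\<forall>X\<in>fst S. is_character G (\<xi> X)"
    and span: "\<forall>h. superclass_function S h \<longrightarrow> (\<exists>c. \<forall>x\<in>carrier G. h x = (\<Sum>X\<in>fst S. c X * \<xi> X x))"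
    by (rule supercharacter_basis[OF G fin S])
  obtain c where c: "\<forall>x\<in>carrier G. h x = (\<Sum>X\<in>fst S. c X * \<xi> X x)"
    using mp[OF spec[OF span] h] ..
  have "h (y \<otimes> x \<otimes> inv y) = (\<Sum>X\<in>fst S. c X * \<xi> X (y \<otimes> x \<otimes> inv y))"
    by (rule bspec[OF c]) (use x y in simp)
  also have "\<dots> = (\<Sum>X\<in>fst S. c X * \<xi> X x)"
  proof (rule sum.cong)
    fix X assume "X \<in> fst S"
    then show "c X * \<xi> X (y \<otimes> x \<otimes> inv y) = c X * \<xi> X x"
      by (intro arg_cong[where f = "\<lambda>z. c X * z"] character_conjugation_invariant[OF G bspec[OF ch] x y])
  qed simp
  also have "\<dots> = h x" by (rule bspec[OF c x, symmetric])
  finally show ?thesis .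
qed

text \<open>
  Since \<open>{\<one>}\<close> is a superclass, the convolution unit is constant on superclasses and so is a
  combination \<open>\<Sum>X. b X * \<xi> X\<close>. Convolution with \<open>\<xi> X\<close> yields \<open>\<xi> X = b X * (\<xi> X * \<xi> X)\<close>, where the last
  product is convolution. So \<open>b X\<close> is nonzero and the span of the \<open>\<xi> X\<close> contains their convolution
  squares.
\<close>

lemma superclass_function_conv:
  fixes G (structure)
  assumes G: "group G" and fin: "finite (carrier G)" and S: "supercharacter_theory G S"
    and f: "superclass_function S f" and h: "superclass_function S h"
  shows "superclass_function S (conv G f h)"
proof -
  interpret group G by fact
  obtain \<xi> where finX: "finite (fst S)" and ch: "\<forall>X\<in>fst S. is_character G (\<xi> X)"
    and sc: "\<forall>X\<in>fst S. superclass_function S (\<xi> X)"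
    and orth': "\<forall>X\<in>fst S. \<forall>Y\<in>fst S. X \<noteq> Y \<longrightarrow> (\<forall>x\<in>carrier G. conv G (\<xi> X) (\<xi> Y) x = 0)"
    and span': "\<forall>h. superclass_function S h \<longrightarrow> (\<exists>c. \<forall>x\<in>carrier G. h x = (\<Sum>X\<in>fst S. c X * \<xi> X x))"
    by (rule supercharacter_basis[OF G fin S])
  have orth: "conv G (\<xi> X) (\<xi> Y) x = 0" if "X \<in> fst S" "Y \<in> fst S" "X \<noteq> Y" "x \<in> carrier G" for X Y x
    using orth' that by simp
  have span: "\<exists>c. \<forall>x\<in>carrier G. h x = (\<Sum>X\<in>fst S. c X * \<xi> X x)" if "superclass_function S h" for h
    by (rule mp[OF spec[OF span'] that])
  have pK: "partition_on (carrier G) (Cl S)" and one: "{\<one>} \<in> Cl S"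
    using S by (auto simp: supercharacter_theory_def)
  have "superclass_function S (\<lambda>y. if y = \<one> then 1 else 0)"
    unfolding superclass_function_def
  proof (intro ballI)
    fix K g h assume K: "K \<in> Cl S" "g \<in> K" "h \<in> K"
    have "K = {\<one>} \<or> K \<inter> {\<one>} = {}" using disjointD[OF partition_onD2[OF pK] K(1) one] by blast
    then show "(if g = \<one> then 1 else 0 :: complex) = (if h = \<one> then 1 else 0)" using K by auto
  qed
  from span[OF this] obtain b where b: "\<forall>y\<in>carrier G. (if y = \<one> then 1 else 0) = (\<Sum>X\<in>fst S. b X * \<xi> X y)" ..
  have self: "\<xi> X x = b X * conv G (\<xi> X) (\<xi> X) x" if X: "X \<in> fst S" and x: "x \<in> carrier G" for X x
  proof -
    have "\<xi> X x = conv G (\<xi> X) (\<lambda>y. if y = \<one> then 1 else 0) x" by (rule conv_delta[OF G fin x, symmetric])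
    also have "\<dots> = conv G (\<xi> X) (\<lambda>y. \<Sum>Y\<in>fst S. b Y * \<xi> Y y) x"
      by (rule conv_cong[OF G x refl bspec[OF b]])
    also have "\<dots> = (\<Sum>Y\<in>fst S. b Y * conv G (\<xi> X) (\<xi> Y) x)" by (rule conv_sum_right)
    also have "\<dots> = (\<Sum>Y\<in>fst S. if Y = X then b X * conv G (\<xi> X) (\<xi> X) x else 0)"
      by (rule sum.cong) (use orth[OF X _ _ x] in auto)
    finally show ?thesis using finX X by simp
  qed
  have b0: "b X \<noteq> 0" if X: "X \<in> fst S" for X
    using self[OF X one_closed] character_one_nonzero[OF G bspec[OF ch X]] by auto
  from span[OF f] obtain c where c: "\<forall>y\<in>carrier G. f y = (\<Sum>X\<in>fst S. c X * \<xi> X y)" ..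
  from span[OF h] obtain d where d: "\<forall>y\<in>carrier G. h y = (\<Sum>X\<in>fst S. d X * \<xi> X y)" ..
  have formula: "conv G f h x = (\<Sum>X\<in>fst S. c X * (d X * (\<xi> X x / b X)))" if x: "x \<in> carrier G" for x
  proof -
    have "conv G f h x = conv G (\<lambda>y. \<Sum>X\<in>fst S. c X * \<xi> X y) (\<lambda>y. \<Sum>Y\<in>fst S. d Y * \<xi> Y y) x"
      by (rule conv_cong[OF G x bspec[OF c] bspec[OF d]])
    also have "\<dots> = (\<Sum>X\<in>fst S. c X * (\<Sum>Y\<in>fst S. d Y * conv G (\<xi> X) (\<xi> Y) x))"
      by (simp only: conv_sum_left conv_sum_right)
    also have "\<dots> = (\<Sum>X\<in>fst S. c X * (d X * (\<xi> X x / b X)))"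
    proof (rule sum.cong)
      fix X assume X: "X \<in> fst S"
      have "(\<Sum>Y\<in>fst S. d Y * conv G (\<xi> X) (\<xi> Y) x) = (\<Sum>Y\<in>fst S. if Y = X then d X * conv G (\<xi> X) (\<xi> X) x else 0)"
        by (rule sum.cong) (use orth[OF X _ _ x] in auto)
      then show "c X * (\<Sum>Y\<in>fst S. d Y * conv G (\<xi> X) (\<xi> Y) x) = c X * (d X * (\<xi> X x / b X))"
        using finX X self[OF X x] b0[OF X] by simp
    qed simp
    finally show ?thesis .
  qed
  show ?thesis
    unfolding superclass_function_def
  proof (intro ballI)
    fix K g k assume K: "K \<in> Cl S" "g \<in> K" "k \<in> K"
    then have "g \<in> carrier G" "k \<in> carrier G" using partition_onD1[OF pK] by auto
    moreover have "\<xi> X g = \<xi> X k" if "X \<in> fst S" for X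
      by (rule superclass_functionD[OF bspec[OF sc that] K])
    ultimately show "conv G f h g = conv G f h k" by (simp add: formula)
  qed
qed

section \<open>Products of superclasses with normal subgroups\<close>

lemma superclass_subset_Union:
  assumes "partition_on A (Cl S)" "\<C> \<subseteq> Cl S" "K \<in> Cl S" "x \<in> K" "x \<in> \<Union>\<C>"
  shows "K \<subseteq> \<Union>\<C>"
proof -
  obtain L where L: "L \<in> \<C>" "x \<in> L" using assms(5) by blast
  then have "K = L" using disjointD[OF partition_onD2[OF assms(1)] assms(3), of L] assms(2,4) by blast
  then show ?thesis using L by blast
qed

lemma superclass_function_indicator_Union:
  assumes "partition_on A (Cl S)" "\<C> \<subseteq> Cl S"
  shows "superclass_function S (\<lambda>x. if x \<in> \<Union>\<C> then 1 else 0)"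
  unfolding superclass_function_def
proof (intro ballI)
  fix K g h assume K: "K \<in> Cl S" "g \<in> K" "h \<in> K"
  have "g \<in> \<Union>\<C> \<longleftrightarrow> h \<in> \<Union>\<C>"
    using superclass_subset_Union[OF assms K(1,2)] superclass_subset_Union[OF assms K(1,3)] K(2,3) by blast
  then show "(if g \<in> \<Union>\<C> then 1 else 0 :: complex) = (if h \<in> \<Union>\<C> then 1 else 0)" by simp
qed

lemma S_normal_superclass:
  assumes S: "supercharacter_theory G S" and N: "S_normal G S N"
    and K: "K \<in> Cl S" "x \<in> K" "x \<in> N"
  shows "K \<subseteq> N"
proof -
  have "partition_on (carrier G) (Cl S)" using S by (simp add: supercharacter_theory_def)
  then show ?thesis using superclass_subset_Union[of "carrier G" S _ K x] N K unfolding S_normal_def by blast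
qed

lemma superclass_function_indicator_S_normal:
  assumes S: "supercharacter_theory G S" and N: "S_normal G S N"
  shows "superclass_function S (\<lambda>x. if x \<in> N then 1 else 0)"
proof -
  obtain \<C> where "\<C> \<subseteq> Cl S" "N = \<Union>\<C>" using N by (auto simp: S_normal_def)
  moreover have "partition_on (carrier G) (Cl S)" using S by (simp add: supercharacter_theory_def)
  ultimately show ?thesis using superclass_function_indicator_Union[of "carrier G" S \<C>] by simp
qed

text \<open>
  The indicator function of \<open>N\<close> is a linear combination of characters, hence invariant under
  conjugation.
\<close>

lemma S_normal_imp_normal:
  fixes G (structure)
  assumes G: "group G" and fin: "finite (carrier G)" and S: "supercharacter_theory G S" and N: "S_normal G S N"
  shows "N \<lhd> G"
proof -
  interpret group G by fact
  have sub: "subgroup N G" using N by (simp add: S_normal_def)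
  have "y \<otimes> x \<otimes> inv y \<in> N" if y: "y \<in> carrier G" and x: "x \<in> N" for x y
    using superclass_function_conjugation_invariant[OF G fin S superclass_function_indicator_S_normal[OF S N]
      subgroup.mem_carrier[OF sub x] y] x by (simp split: if_splits)
  then show ?thesis using sub by (simp add: normal_inv_iff)
qed

text \<open>
  The convolution of the indicator functions of \<open>N\<close> and \<open>K\<close> counts the factorizations of an element
  in \<open>N <#> K\<close>. It is constant on superclasses, and so is the property of being nonzero.
\<close>

lemma set_mult_superclass_closed:
  fixes G (structure)
  assumes G: "group G" and fin: "finite (carrier G)" and S: "supercharacter_theory G S" and N: "S_normal G S N"
    and K: "K \<in> Cl S" and L: "L \<in> Cl S" and x: "x \<in> L" "x \<in> N <#> K"
  shows "L \<subseteq> N <#> K"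
proof
  fix z assume z: "z \<in> L"
  interpret group G by fact
  have sub: "subgroup N G" using N by (simp add: S_normal_def)
  have pK: "partition_on (carrier G) (Cl S)" using S by (simp add: supercharacter_theory_def)
  have Kc: "K \<subseteq> carrier G" and Lc: "L \<subseteq> carrier G" using partition_onD1[OF pK] K L by auto
  let ?n = "\<lambda>x. if x \<in> N then 1 else 0 :: complex" and ?k = "\<lambda>x. if x \<in> K then 1 else 0 :: complex"
  have count: "conv G ?n ?k w = of_nat (card {y \<in> carrier G. y \<in> N \<and> inv y \<otimes> w \<in> K})" for w
  proof -
    have "conv G ?n ?k w = (\<Sum>y\<in>carrier G. if y \<in> N \<and> inv y \<otimes> w \<in> K then 1 else 0)"
      unfolding conv_def by (rule sum.cong) auto
    also have "\<dots> = of_nat (card (carrier G \<inter> {y. y \<in> N \<and> inv y \<otimes> w \<in> K}))"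
      using fin by (simp add: sum.If_cases)
    finally show ?thesis by (simp add: Int_def)
  qed
  have mem: "conv G ?n ?k w \<noteq> 0 \<longleftrightarrow> w \<in> N <#> K" if w: "w \<in> carrier G" for w
  proof -
    have "conv G ?n ?k w \<noteq> 0 \<longleftrightarrow> (\<exists>y\<in>carrier G. y \<in> N \<and> inv y \<otimes> w \<in> K)"
      unfolding count using fin by (auto simp: card_eq_0_iff)
    also have "\<dots> \<longleftrightarrow> w \<in> N <#> K"
    proof
      assume "\<exists>y\<in>carrier G. y \<in> N \<and> inv y \<otimes> w \<in> K"
      then obtain y where y: "y \<in> carrier G" "y \<in> N" "inv y \<otimes> w \<in> K" by blast
      have "w = y \<otimes> (inv y \<otimes> w)" using y(1) w by (simp add: m_assoc[symmetric])
      then show "w \<in> N <#> K" using y unfolding set_mult_def by blast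
    next
      assume "w \<in> N <#> K"
      then obtain y k where y: "y \<in> N" "k \<in> K" "w = y \<otimes> k" by (auto simp: set_mult_def)
      have "y \<in> carrier G" "k \<in> carrier G" using y sub Kc by (auto simp: subgroup.mem_carrier)
      then show "\<exists>y\<in>carrier G. y \<in> N \<and> inv y \<otimes> w \<in> K" using y
        by (intro bexI[of _ y]) (simp_all add: m_assoc[symmetric])
    qed
    finally show ?thesis .
  qed
  have "superclass_function S ?k"
    using superclass_function_indicator_Union[OF pK, of "{K}"] K by simp
  then have "superclass_function S (conv G ?n ?k)"
    by (rule superclass_function_conv[OF G fin S superclass_function_indicator_S_normal[OF S N]])
  then have "conv G ?n ?k x = conv G ?n ?k z" by (rule superclass_functionD[OF _ L x(1) z])
  then show "z \<in> N <#> K" using mem[of x] mem[of z] x z Lc by auto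
qed

lemma rcos_image_subset:
  fixes G (structure)
  assumes G: "group G" and N: "subgroup N G" and K: "K \<subseteq> carrier G" and L: "L \<subseteq> carrier G"
    and sub: "L \<subseteq> N <#> K"
  shows "(\<lambda>x. N #> x) ` L \<subseteq> (\<lambda>x. N #> x) ` K"
proof
  interpret group G by fact
  fix C assume "C \<in> (\<lambda>x. N #> x) ` L"
  then obtain x where x: "x \<in> L" "C = N #> x" by blast
  then obtain n k where nk: "n \<in> N" "k \<in> K" "x = n \<otimes> k" using sub by (force simp: set_mult_def)
  have "N #> x = N #> k"
    unfolding nk(3) using nk N K subgroup.mem_carrier[OF N nk(1)] subgroup.subset[OF N]
    by (subst coset_mult_assoc[symmetric]) (auto simp: coset_join2)
  then show "C \<in> (\<lambda>x. N #> x) ` K" using x nk by blast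
qed

text \<open>
  The images of superclasses in \<open>G / N\<close> are equal as soon as they meet: if \<open>k = n \<otimes> l\<close>, then \<open>N <#> L\<close>
  meets \<open>K\<close> and \<open>N <#> K\<close> meets \<open>L\<close>, and both products are unions of superclasses.
\<close>

lemma superclass_image_eq:
  fixes G (structure)
  assumes G: "group G" and fin: "finite (carrier G)" and S: "supercharacter_theory G S" and N: "S_normal G S N"
    and K: "K \<in> Cl S" and L: "L \<in> Cl S" and kl: "k \<in> K" "l \<in> L" "n \<in> N" "k = n \<otimes> l"
  shows "(\<lambda>x. N #> x) ` K = (\<lambda>x. N #> x) ` L"
proof -
  interpret group G by fact
  have sub: "subgroup N G" using N by (simp add: S_normal_def)
  have pK: "partition_on (carrier G) (Cl S)" using S by (simp add: supercharacter_theory_def)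
  have Kc: "K \<subseteq> carrier G" and Lc: "L \<subseteq> carrier G" using partition_onD1[OF pK] K L by auto
  have nc: "n \<in> carrier G" "k \<in> carrier G" "l \<in> carrier G" using kl Kc Lc subgroup.mem_carrier[OF sub] by auto
  have "k \<in> N <#> L" using kl by (auto simp: set_mult_def)
  then have 1: "K \<subseteq> N <#> L" by (rule set_mult_superclass_closed[OF G fin S N L K kl(1)])
  have "inv n \<otimes> k = l" unfolding kl(4) using nc by (simp add: m_assoc[symmetric])
  moreover have "inv n \<otimes> k \<in> N <#> K"
    unfolding set_mult_def using subgroup.m_inv_closed[OF sub kl(3)] kl(1) by blast
  ultimately have "l \<in> N <#> K" by simp
  then have 2: "L \<subseteq> N <#> K" by (rule set_mult_superclass_closed[OF G fin S N K L kl(2)])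
  show ?thesis
    using rcos_image_subset[OF G sub Lc Kc 1] rcos_image_subset[OF G sub Kc Lc 2] by blast
qed

theorem theorem1:
  fixes G :: "('a, 'b) monoid_scheme" (structure)
    and S :: "'a supercharacter_pair"
    and H N :: "'a set"
    and \<phi> :: "'a set \<Rightarrow> 'a set"
  assumes "group G" and "finite (carrier G)"
    and "supercharacter_theory G S"
    and "S_normal G S H" and "S_normal G S N"
    and "\<And>h. h \<in> H \<Longrightarrow> \<phi> ((H \<inter> N) #> h) = N #> h"
  shows "isomorphic_via (quotient_group G H (H \<inter> N)) (quotient_group G (H <#> N) N) \<phi>
           (induced_theory G S H (H \<inter> N)) (induced_theory G S (H <#> N) N)"
proof -
  interpret group G by fact
  note GS = assms(1,2,3)
  have pK: "partition_on (carrier G) (Cl S)" using assms(3) by (simp add: supercharacter_theory_def)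
  have sH: "subgroup H G" and sN: "subgroup N G" using assms(4,5) by (auto simp: S_normal_def)
  have nN: "N \<lhd> G" by (rule S_normal_imp_normal[OF GS assms(5)])
  interpret second_isomorphism_grp N G H
    using nN sH by (simp add: second_isomorphism_grp_def second_isomorphism_grp_axioms_def)
  have HN: "H <#> N = N <#> H" by (rule commut_normal[OF sH nN])
  have Hc: "H \<subseteq> carrier G" by (rule subgroup.subset[OF sH])
  have HHN: "H \<subseteq> H <#> N" unfolding HN by (rule S_contained_in_set_mult)
  let ?\<psi> = "\<lambda>X. the_elem ((\<lambda>g. N #> g) ` X)"
  have iso: "?\<psi> \<in> iso (quotient_group G H (H \<inter> N)) (quotient_group G (H <#> N) N)"
    using normal_intersection_quotient_isom unfolding HN Int_commute[of H N] .
  have car: "carrier (quotient_group G H (H \<inter> N)) = {(H \<inter> N) #> h | h. h \<in> H}"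
    by (auto simp: FactGroup_def RCOSETS_def r_coset_def)
  \<comment> \<open>\<open>\<phi>\<close> is prescribed only on cosets of elements of \<open>H\<close>, so it is compared with the isomorphism
    \<open>?\<psi>\<close> on the carrier\<close>
  have agree: "\<phi> X = ?\<psi> X" if X0: "X \<in> carrier (quotient_group G H (H \<inter> N))" for X
  proof -
    obtain h where h: "h \<in> H" and X: "X = (H \<inter> N) #> h" using X0 unfolding car by blast
    have hc: "h \<in> carrier G" using h Hc by auto
    have same: "N #> (n \<otimes> h) = N #> h" if "n \<in> N" for n
      using that hc subgroup.subset[OF sN]
      by (subst coset_mult_assoc[symmetric]) (auto simp: coset_join2[OF _ sN])
    have ne: "H \<inter> N \<noteq> {}" using subgroup.one_closed[OF sH] subgroup.one_closed[OF sN] by blast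
    have "X = (\<lambda>n. n \<otimes> h) ` (H \<inter> N)" unfolding X r_coset_def by blast
    then have "(\<lambda>g. N #> g) ` X = (\<lambda>n. N #> (n \<otimes> h)) ` (H \<inter> N)" by (simp only: image_image)
    also have "\<dots> = (\<lambda>n. N #> h) ` (H \<inter> N)" by (rule image_cong) (simp_all add: same)
    also have "\<dots> = {N #> h}" by (rule image_constant_conv[THEN trans]) (simp add: ne)
    finally have "(\<lambda>g. N #> g) ` X = {N #> h}" .
    then show ?thesis using assms(6)[OF h] X by simp
  qed
  have grp: "group (quotient_group G H (H \<inter> N))"
  proof -
    have "N \<inter> H \<lhd> G\<lparr>carrier := H\<rparr>"
      using normal_subgrp_intersection_normal by (simp add: Int_commute)
    then show ?thesis by (simp add: Int_commute normal.factorgroup_is_group)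
  qed
  have "\<phi> \<in> iso (quotient_group G H (H \<inter> N)) (quotient_group G (H <#> N) N)"
  proof -
    let ?A = "quotient_group G H (H \<inter> N)" and ?B = "quotient_group G (H <#> N) N"
    have hom: "?\<psi> \<in> hom ?A ?B" using iso by (simp add: Group.iso_def)
    have "\<phi> \<in> hom ?A ?B"
    proof (rule homI)
      fix X Y assume X: "X \<in> carrier ?A" and Y: "Y \<in> carrier ?A"
      show "\<phi> X \<in> carrier ?B" unfolding agree[OF X] by (rule hom_in_carrier[OF hom X])
      have XY: "X \<otimes>\<^bsub>?A\<^esub> Y \<in> carrier ?A" by (rule monoid.m_closed[OF group.is_monoid[OF grp] X Y])
      show "\<phi> (X \<otimes>\<^bsub>?A\<^esub> Y) = \<phi> X \<otimes>\<^bsub>?B\<^esub> \<phi> Y"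
        unfolding agree[OF X] agree[OF Y] agree[OF XY] by (rule hom_mult[OF hom X Y])
    qed
    moreover have "bij_betw \<phi> (carrier (quotient_group G H (H \<inter> N))) (carrier (quotient_group G (H <#> N) N))"
      using iso bij_betw_cong[of _ \<phi> ?\<psi>, OF agree] by (simp add: Group.iso_def)
    ultimately show ?thesis by (simp add: Group.iso_def)
  qed
  moreover have "induced_classes G S (H <#> N) N = {\<phi> ` K | K. K \<in> induced_classes G S H (H \<inter> N)}"
  proof -
    have img: "\<phi> ` (\<lambda>x. (H \<inter> N) #> x) ` K = (\<lambda>x. N #> x) ` K" if "K \<subseteq> H" for K
      using that assms(6) by (auto simp: image_image intro!: image_cong)
    have "\<exists>L\<in>Cl S. L \<subseteq> H \<and> (\<lambda>x. N #> x) ` K = (\<lambda>x. N #> x) ` L" if K: "K \<in> Cl S" "K \<subseteq> H <#> N" for K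
    proof -
      obtain k where k: "k \<in> K" using partition_onD3[OF pK] K(1) by (metis ex_in_conv)
      then obtain n h where nh: "n \<in> N" "h \<in> H" "k = n \<otimes> h"
        using K(2) unfolding HN by (auto simp: set_mult_def)
      \<comment> \<open>the superclass of the component of \<open>k\<close> in \<open>H\<close> lies in \<open>H\<close> and has the same image\<close>
      obtain L where L: "L \<in> Cl S" "h \<in> L" using partition_onD1[OF pK] nh(2) Hc by blast
      have "L \<subseteq> H" by (rule S_normal_superclass[OF assms(3,4) L nh(2)])
      moreover have "(\<lambda>x. N #> x) ` K = (\<lambda>x. N #> x) ` L"
        by (rule superclass_image_eq[OF GS assms(5) K(1) L(1) k L(2) nh(1,3)])
      ultimately show ?thesis using L(1) by blast
    qed
    then have sub1: "C \<in> {(\<lambda>x. N #> x) ` L | L. L \<in> Cl S \<and> L \<subseteq> H}"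
      if "C \<in> induced_classes G S (H <#> N) N" for C
      using that unfolding induced_classes_def by fastforce
    have sub2: "C \<in> induced_classes G S (H <#> N) N"
      if "C \<in> {(\<lambda>x. N #> x) ` L | L. L \<in> Cl S \<and> L \<subseteq> H}" for C
      using that HHN unfolding induced_classes_def by fastforce
    have "induced_classes G S (H <#> N) N = {(\<lambda>x. N #> x) ` L | L. L \<in> Cl S \<and> L \<subseteq> H}"
      by (rule subset_antisym[OF subsetI subsetI]) (erule sub1, erule sub2)
    also have "\<dots> = (\<lambda>L. (\<lambda>x. N #> x) ` L) ` {L \<in> Cl S. L \<subseteq> H}"
      by (rule setcompr_eq_image)
    also have "\<dots> = (\<lambda>L. \<phi> ` (\<lambda>x. (H \<inter> N) #> x) ` L) ` {L \<in> Cl S. L \<subseteq> H}"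
      by (rule image_cong) (simp_all add: img)
    also have "\<dots> = (\<lambda>K. \<phi> ` K) ` (\<lambda>L. (\<lambda>x. (H \<inter> N) #> x) ` L) ` {L \<in> Cl S. L \<subseteq> H}"
      by (rule image_image[symmetric])
    also have "(\<lambda>L. (\<lambda>x. (H \<inter> N) #> x) ` L) ` {L \<in> Cl S. L \<subseteq> H} = induced_classes G S H (H \<inter> N)"
      unfolding induced_classes_def by (rule setcompr_eq_image[symmetric])
    also have "(\<lambda>K. \<phi> ` K) ` \<dots> = {\<phi> ` K | K. K \<in> induced_classes G S H (H \<inter> N)}"
      by blast
    finally show ?thesis .
  qed
  ultimately show ?thesis by (simp add: isomorphic_via_def induced_theory_def)
qed

end
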